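(* Let $\mathbf{q}^r\in\mathbb{R}^m$ be such that the regularity assumption (R) in the context holds on $\mathcal{B}_*(\mathbf{q}^r)$, let $T>0$, and let $k_1,\dots,k_N,k_L>0$. Let $\mu=\tfrac12 abR$, $\overline{\tau}_o(\mu)$ and $\rho(\mu)$ be as defined in the context, and consider the sampled system $$\dot{\mathbf{q}}(t)=-k\,\mathbf{A}_{\mathbf{q}(t)}^{\dagger}\mathbf{A}_{\mathbf{q}(jT)}\overline{\mathbf{K}}\,(\mathbf{q}(jT)-\mathbf{q}^r),\qquad jT\le t<(j+1)T,\quad j=0,1,2,\dots,$$ with constant gain $k=k^*:=\overline{\tau}_o(\mu)/T$. Put $\mathbf{e}(t)=\mathbf{q}(t)-\mathbf{q}^r$. Then for all $\mathbf{e}(0)$ with $\mathbf{e}(0)+\mathbf{q}^r\in\mathcal{B}_*(\mathbf{q}^r)$ and all integers $j\ge0$, $$\|\mathbf{e}(jT)\|\le\rho(\mu)^j\,\|\mathbf{e}(0)\|,$$ and $\|\mathbf{e}(t)\|\le\|\mathbf{e}(jT)\|$ for all $jT\le t<(j+1)T$.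
   Context: Let $\mathbf{q}=(\mathbf{q}_1,\dots,\mathbf{q}_N,\mathbf{q}_L)\in\mathbb{R}^m$ with $\mathbf{q}_i\in\mathbb{R}^{m_i}$, $\mathbf{q}_L\in\mathbb{R}^{m_L}$, $m=\sum_i m_i+m_L$, and let $\mathbf{p}=(\mathbf{p}_1,\dots,\mathbf{p}_N)\in\mathbb{R}^n$, $\mathbf{p}_i\in\mathbb{R}^{n_i}$, $n=\sum_i n_i$, with $n>m$. The kinematic map is $\mathbf{p}=\mathbf{h}(\mathbf{q})$ with star structure $\mathbf{p}_i=\mathbf{h}^{(i)}(\mathbf{q}_i,\mathbf{q}_L)$; $\mathbf{A}_{\mathbf{q}}=\partial\mathbf{h}(\mathbf{q})/\partial\mathbf{q}\in\mathbb{R}^{n\times m}$ is its Jacobian, and $\mathbf{A}_{\mathbf{q}}^\dagger=(\mathbf{A}_{\mathbf{q}}^\top\mathbf{A}_{\mathbf{q}})^{-1}\mathbf{A}_{\mathbf{q}}^\top$ its pseudo-inverse. Norms: $d_1,\dots,d_N,d_L\ge 1$ are given reals and $\mathbf{D}=\mathrm{diag}(d_1^{-2}\mathbf{I}_{m_1},\dots,d_N^{-2}\mathbf{I}_{m_N},d_L^{-2}\mathbf{I}_{m_L})$. Put $\|x\|_{\mathbf{D},2}=\|\mathbf{D}x\|_2$ and $\|x\|_{\mathbf{D},\infty}=\|\mathbf{D}x\|_\infty$. Fix $R>0$ and $*\in\{2,\infty\}$ (either choice); $\|\cdot\|$ denotes $\|\cdot\|_{\mathbf{D},*}$ on vectors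 and the induced operator norm on matrices, and $\mathcal{B}_*(\mathbf{q}^r)=\{\mathbf{q}\in\mathbb{R}^m : \|\mathbf{q}-\mathbf{q}^r\|<R\}$. Assumption (R): $\mathbf{h}$ is three times continuously differentiable and $\mathbf{A}_{\mathbf{q}}$ has full (column) rank $m$ on $\mathcal{B}_*(\mathbf{q}^r)$, and these properties extend by continuity to the closure $\overline{\mathcal{B}}_*(\mathbf{q}^r)$ ($\mathbf{h}$ and its partial derivatives up to order three extend continuously to the closure, and the extended Jacobian has full rank there). Gains: $\overline{\mathbf{K}}=\mathrm{diag}(k_1\mathbf{I}_{m_1},\dots,k_N\mathbf{I}_{m_N},k_L\mathbf{I}_{m_L})$. Constants: put $\mathbf{f}(\mathbf{e}';\mathbf{e})=-\mathbf{A}^\dagger_{\mathbf{q}^r+\mathbf{e}'}\mathbf{A}_{\mathbf{q}^r+\mathbf{e}}\overline{\mathbf{K}}\,\mathbf{e}$. The reals $a,b>0$ are any constants such that, for all $\mathbf{e},\mathbf{e}'$ with $\mathbf{q}^r+\mathbf{e},\ \mathbf{q}^r+\mathbf{e}'\in\mathcal{B}_*(\mathbf{q}^r)$, one has $\|\mathbf{f}(\mathbf{e}';\mathbf{e})\|\le a\|\mathbf{e}\|$ and $\left\|\partial\mathbf{f}(\mathbf{e}';\mathbf{e})/\partial\mathbf{e}'\right\|\le b\|\mathbf{e}\|$ (such constants exist under (R)). Set $\mu=\tfrac12abR$ and $$g(\tau;\mu)=\|\mathbf{I}-\tau\overline{\mathbf{K}}\|+\mu\tau^2,\quad \tau\ge0.$$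 Let $\overline{\tau}_s(\mu)$ be the $\tau>0$ with $g(\tau;\mu)=1$, let $\overline{\tau}_o(\mu)=\operatorname{argmin}_{0\le\tau\le\overline{\tau}_s(\mu)}g(\tau;\mu)$, and let $\rho(\mu)=g(\overline{\tau}_o(\mu);\mu)$, which satisfies $\rho(\mu)<1$. *)

theory Defs
  imports "HOL-Analysis.Analysis"
begin

(* Block structure.  A finite type 'a indexes the agents 1, ..., N.  The coordinates of
   q = (q_1, ..., q_N, q_L) are indexed by 'm, and a map blk :: 'm => 'a option says to which
   block a coordinate belongs: Some i for q_i, None for q_L.  Thus m_i is the cardinality of
   blk -` {Some i} and m_L that of blk -` {None}.  The coordinates of p = (p_1, ..., p_N) are
   indexed by 'n and assigned to agents by a map pblk :: 'n => 'a. *)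

definition subvec :: "('m::finite \<Rightarrow> 'b) \<Rightarrow> 'b \<Rightarrow> real^'m \<Rightarrow> ('m \<Rightarrow> real)" where
  "subvec blk b q = restrict (\<lambda>c. q $ c) {c. blk c = b}"

definition star_structure ::
  "('m::finite \<Rightarrow> 'a option) \<Rightarrow> ('n::finite \<Rightarrow> 'a) \<Rightarrow> (real^'m \<Rightarrow> real^'n) \<Rightarrow> bool" where
  "star_structure blk pblk h \<longleftrightarrow>
     (\<exists>hloc :: 'a \<Rightarrow> ('m \<Rightarrow> real) \<Rightarrow> ('m \<Rightarrow> real) \<Rightarrow> ('n \<Rightarrow> real).
        \<forall>q i. subvec pblk i (h q) =
                restrict (hloc i (subvec blk (Some i) q) (subvec blk None q)) {r. pblk r = i})"

definition block_diag :: "('m::finite \<Rightarrow> 'b) \<Rightarrow> ('b \<Rightarrow> real) \<Rightarrow> real^'m^'m" where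
  "block_diag blk w = (\<chi> r c. if r = c then w (blk r) else 0)"

definition weight_matrix :: "('m::finite \<Rightarrow> 'b) \<Rightarrow> ('b \<Rightarrow> real) \<Rightarrow> real^'m^'m" where
  "weight_matrix blk d = block_diag blk (\<lambda>b. 1 / (d b)\<^sup>2)"

datatype norm_kind = Two | Infty

primrec weighted_norm :: "norm_kind \<Rightarrow> real^'m^'m \<Rightarrow> real^'m \<Rightarrow> real" where
  "weighted_norm Two D x = norm (D *v x)"
| "weighted_norm Infty D x = infnorm (D *v x)"

(* The term at x = 0 is 0 / 0 = 0, as in the library's onorm. *)
definition induced_norm :: "(real^'m \<Rightarrow> real) \<Rightarrow> real^'m^'m \<Rightarrow> real" where
  "induced_norm nrm M = (SUP x. nrm (M *v x) / nrm x)"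

definition norm_ball :: "(real^'m \<Rightarrow> real) \<Rightarrow> real^'m \<Rightarrow> real \<Rightarrow> (real^'m) set" where
  "norm_ball nrm x0 R = {x. nrm (x - x0) < R}"

definition partial_deriv :: "'m::finite \<Rightarrow> (real^'m \<Rightarrow> real^'n) \<Rightarrow> real^'m \<Rightarrow> real^'n" where
  "partial_deriv c f x = frechet_derivative f (at x) (axis c 1)"

primrec iterated_partial :: "'m::finite list \<Rightarrow> (real^'m \<Rightarrow> real^'n) \<Rightarrow> real^'m \<Rightarrow> real^'n" where
  "iterated_partial [] f = f"
| "iterated_partial (c # cs) f = partial_deriv c (iterated_partial cs f)"

(* k times continuously differentiable; used for open U only *)
definition Ck_on :: "nat \<Rightarrow> (real^'m) set \<Rightarrow> (real^'m::finite \<Rightarrow> real^'n) \<Rightarrow> bool" where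
  "Ck_on k U f \<longleftrightarrow>
     (\<forall>cs. length cs < k \<longrightarrow> (\<forall>x\<in>U. iterated_partial cs f differentiable at x)) \<and>
     (\<forall>cs. length cs \<le> k \<longrightarrow> continuous_on U (iterated_partial cs f))"

definition extends_to_closure ::
  "(real^'m) set \<Rightarrow> (real^'m \<Rightarrow> 'b::topological_space) \<Rightarrow> (real^'m \<Rightarrow> 'b) \<Rightarrow> bool" where
  "extends_to_closure U F G \<longleftrightarrow> continuous_on (closure U) G \<and> (\<forall>x\<in>U. G x = F x)"

abbreviation jac :: "(real^'m \<Rightarrow> real^'n) \<Rightarrow> real^'m \<Rightarrow> real^'m^'n" where
  "jac h q \<equiv> jacobian h (at q)"

definition regular_on :: "(real^'m) set \<Rightarrow> (real^'m::finite \<Rightarrow> real^'n) \<Rightarrow> bool" where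
  "regular_on U h \<longleftrightarrow>
     Ck_on 3 U h \<and>
     (\<forall>q\<in>U. rank (jac h q) = CARD('m)) \<and>
     (\<forall>cs. length cs \<le> 3 \<longrightarrow> (\<exists>G. extends_to_closure U (iterated_partial cs h) G)) \<and>
     (\<exists>J. extends_to_closure U (jac h) J \<and> (\<forall>q\<in>closure U. rank (J q) = CARD('m)))"

definition pseudo_inv :: "real^'m^'n \<Rightarrow> real^'n^'m" where
  "pseudo_inv A = matrix_inv (transpose A ** A) ** transpose A"

(* f(e'; e); the first vector argument is e' *)
definition f_field ::
  "(real^'m \<Rightarrow> real^'n) \<Rightarrow> real^'m^'m \<Rightarrow> real^'m \<Rightarrow> real^'m \<Rightarrow> real^'m \<Rightarrow> real^'m" where
  "f_field h K qr e' e = - ((pseudo_inv (jac h (qr + e')) ** jac h (qr + e) ** K) *v e)"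

definition g_fun :: "(real^'m \<Rightarrow> real) \<Rightarrow> real^'m^'m \<Rightarrow> real \<Rightarrow> real \<Rightarrow> real" where
  "g_fun nrm K \<mu> \<tau> = induced_norm nrm (mat 1 - \<tau> *\<^sub>R K) + \<mu> * \<tau>\<^sup>2"

(* For \<mu> > 0 and positive gains g is strictly convex with g(0) = 1 and negative slope at 0,
   so both the positive root of g = 1 and the minimizer below exist and are unique. *)
definition tau_s :: "(real^'m \<Rightarrow> real) \<Rightarrow> real^'m^'m \<Rightarrow> real \<Rightarrow> real" where
  "tau_s nrm K \<mu> = (THE \<tau>. \<tau> > 0 \<and> g_fun nrm K \<mu> \<tau> = 1)"

definition tau_o :: "(real^'m \<Rightarrow> real) \<Rightarrow> real^'m^'m \<Rightarrow> real \<Rightarrow> real" where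
  "tau_o nrm K \<mu> = arg_min_on (g_fun nrm K \<mu>) {0..tau_s nrm K \<mu>}"

definition rho :: "(real^'m \<Rightarrow> real) \<Rightarrow> real^'m^'m \<Rightarrow> real \<Rightarrow> real" where
  "rho nrm K \<mu> = g_fun nrm K \<mu> (tau_o nrm K \<mu>)"

(* Trajectories on [0, \<infinity>): continuous, with the differential equation holding on each
   [jT, (j+1)T); at the sampling instant jT the derivative is the one from the right. *)
definition sampled_solution ::
  "(real^'m \<Rightarrow> real^'n) \<Rightarrow> real^'m^'m \<Rightarrow> real^'m \<Rightarrow> real \<Rightarrow> real \<Rightarrow> (real \<Rightarrow> real^'m) \<Rightarrow> bool" where
  "sampled_solution h K qr T k q \<longleftrightarrow>
     continuous_on {0..} q \<and>
     (\<forall>j::nat. \<forall>t\<in>{real j * T..<(real j + 1) * T}.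
        (q has_vector_derivative
           - (k *\<^sub>R ((pseudo_inv (jac h (q t)) ** jac h (q (real j * T)) ** K)
                       *v (q (real j * T) - qr))))
        (at t within {real j * T..<(real j + 1) * T}))"

end

theory Submission
  imports Defs
begin

text \<open>On one sampling interval the error e satisfies e' = k f(e; e_j), where e_j is the error at
  the last sampling instant and f(e_j; e_j) = - K e_j because the pseudo-inverse is a left inverse.
  The bounds by a and b make the deviation of the trajectory from the explicit Euler step
  (I - k s K) e_j at most (k s)^2 a b |e_j|^2 / 2, so that |e| is at most g(k s) |e_j| as long as the
  trajectory stays in the ball. Strict convexity of g gives g \<le> 1 on [0, \<tau>_s], hence up to the minimizer, so the
  trajectory cannot leave the ball at all, and s = T yields the factor \<rho>.
  Integral estimates for both norms are reduced to scalar monotonicity by testing with a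
  functional that supports the norm.\<close>

text \<open>The bounds by \<open>a\<close> and \<open>b\<close> and the regularity of
  \<open>h\<close> hold only in the open ball, so every estimate presupposes that the trajectory is
  still there. A first exit time breaks this circle: the estimate at time u needs the trajectory
  inside only before u, and it returns a norm of at most the starting value, which is below R. The
  same argument serves existence, where the field is altered outside a smaller ball and the solution
  is shown to stay where nothing was altered. The constant \<mu> = a b R / 2 comes from freezing the
  sampled error e: the field then has size at most a |e| and Lipschitz constant b |e|, so the defect
  from the Euler step is quadratic in |e|, and one factor |e| < R is given up. A bound on
  \<open>jacobian\<close> controls increments only where the map is differentiable, because
  \<open>jacobian\<close> rests on the choice operator behind \<open>frechet_derivative\<close>.
  Differentiability of the pseudo-inverse is therefore proved separately.\<close>

subsection \<open>Global solutions of Lipschitz differential equations\<close>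

text \<open>Supplies the trajectory on one sampling interval. For u(t) = exp(-2 L t) x(t) in the sup
  norm, the rate 2 L against the Lipschitz constant L gives the contraction factor 1/2 whatever the
  length T.\<close>

lemma picard_lindelof_global:
  fixes G :: "'a::banach \<Rightarrow> 'a"
  assumes L: "L > 0" and lip: "\<And>x y. norm (G x - G y) \<le> L * norm (x - y)" and T: "T \<ge> 0"
  shows "\<exists>x. x 0 = x0 \<and>
    (\<forall>t\<in>{0..T}. (x has_vector_derivative G (x t)) (at t within {0..T}))"
proof -
  \<comment> \<open>the exponential weight makes the Picard operator a contraction on all of [0, T] at once\<close>
  define \<Phi> where "\<Phi> u t = exp (-(2 * L * t)) *\<^sub>R (x0 + integral {0..t} (\<lambda>s. G (exp (2 * L * s) *\<^sub>R u s)))"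
    for u :: "real \<Rightarrow> 'a" and t :: real
  have contG: "continuous_on S G" for S
  proof (rule lipschitz_on_continuous_on[of L])
    show "L-lipschitz_on S G"
      using L lip by (auto simp: lipschitz_on_def dist_norm)
  qed
  have cont_integrand: "continuous_on {0..t} (\<lambda>s. G (exp (2 * L * s) *\<^sub>R apply_bcontfun u s))"
    for u :: "real \<Rightarrow>\<^sub>C 'a" and t
    by (rule continuous_on_compose2[OF contG]) (auto intro!: continuous_intros)
  \<comment> \<open>The fixed point is sought among bounded continuous functions on the whole line,
    a complete space; \<open>clamp\<close> extends a function from [0, T] to it by
    constants.\<close>
  have "\<exists>v. \<forall>t. apply_bcontfun v t = \<Phi> (apply_bcontfun u) (clamp 0 T t)" for u :: "real \<Rightarrow>\<^sub>C 'a"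
  proof -
    have "continuous_on {0..T} (\<Phi> (apply_bcontfun u))"
      unfolding \<Phi>_def
      by (intro continuous_intros indefinite_integral_continuous_1 integrable_continuous_real
          cont_integrand)
    then have "continuous_on (cbox 0 T) (\<Phi> (apply_bcontfun u))" by simp
    then obtain g where "\<And>x. x \<in> cbox 0 T \<Longrightarrow> apply_bcontfun g x = \<Phi> (apply_bcontfun u) x"
      "\<And>x. apply_bcontfun g x = \<Phi> (apply_bcontfun u) (clamp 0 T x)"
      by (rule continuous_on_cbox_bcontfunE) blast
    then show ?thesis by auto
  qed
  then obtain P where P: "\<And>u t. apply_bcontfun (P u) t = \<Phi> (apply_bcontfun u) (clamp 0 T t)"
    by metis
  have contr: "dist (P u) (P v) \<le> 1/2 * dist u v" for u v
  proof (rule dist_bound)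
    fix t'
    define t where "t = clamp 0 T t'"
    have t: "0 \<le> t" "t \<le> T" using clamp_in_interval[of 0 T t'] T by (auto simp: t_def)
    let ?I = "\<lambda>u. integral {0..t} (\<lambda>s. G (exp (2 * L * s) *\<^sub>R apply_bcontfun u s))"
    have FT: "((\<lambda>s. L * exp (2 * L * s) * dist u v) has_integral
        (exp (2 * L * t) * dist u v / 2 - exp (2 * L * 0) * dist u v / 2)) {0..t}"
      by (rule fundamental_theorem_of_calculus[OF t(1)])
        (use L in \<open>auto intro!: derivative_eq_intros
          simp flip: has_real_derivative_iff_has_vector_derivative\<close>)
    have "norm (?I u - ?I v)
        = norm (integral {0..t} (\<lambda>s. G (exp (2 * L * s) *\<^sub>R u s) - G (exp (2 * L * s) *\<^sub>R v s)))"
      by (subst integral_diff) (auto intro!: integrable_continuous_real cont_integrand)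
    also have "\<dots> \<le> integral {0..t} (\<lambda>s. L * exp (2 * L * s) * dist u v)"
    proof (rule integral_norm_bound_integral)
      fix s assume "s \<in> {0..t}"
      have "norm (G (exp (2 * L * s) *\<^sub>R u s) - G (exp (2 * L * s) *\<^sub>R v s))
          \<le> L * norm (exp (2 * L * s) *\<^sub>R (u s - v s))"
        using lip by (metis scaleR_diff_right)
      also have "\<dots> = L * exp (2 * L * s) * dist (u s) (v s)" by (simp add: dist_norm)
      also have "\<dots> \<le> L * exp (2 * L * s) * dist u v"
        using L by (intro mult_left_mono dist_bounded) auto
      finally show "norm (G (exp (2 * L * s) *\<^sub>R u s) - G (exp (2 * L * s) *\<^sub>R v s))
          \<le> L * exp (2 * L * s) * dist u v" .
    qed (use FT in \<open>auto intro!: integrable_continuous_real continuous_on_diff cont_integrand continuous_intros\<close>)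
    also have "\<dots> = exp (2 * L * t) * dist u v / 2 - exp (2 * L * 0) * dist u v / 2"
      using FT by (rule integral_unique)
    also have "\<dots> \<le> exp (2 * L * t) * dist u v / 2" by simp
    finally have "exp (-(2 * L * t)) * norm (?I u - ?I v)
        \<le> exp (-(2 * L * t)) * (exp (2 * L * t) * dist u v / 2)"
      by (intro mult_left_mono) auto
    also have "\<dots> = 1/2 * dist u v"
      by (simp add: exp_minus)
    finally have "exp (-(2 * L * t)) * norm (?I u - ?I v) \<le> 1/2 * dist u v" .
    moreover have "P u t' - P v t' = exp (-(2 * L * t)) *\<^sub>R (?I u - ?I v)"
      by (simp add: P \<Phi>_def t_def scaleR_diff_right scaleR_add_right)
    ultimately show "dist (P u t') (P v t') \<le> 1/2 * dist u v"
      by (simp add: dist_norm)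
  qed
  obtain u where u: "P u = u"
    using banach_fix_type[of "1/2" P] contr by auto
  \<comment> \<open>Removes the weight from the fixed point. Written as an integral of the known u,
    x can be differentiated directly.\<close>
  define x where "x t = x0 + integral {0..t} (\<lambda>s. G (exp (2 * L * s) *\<^sub>R u s))" for t
  have xu: "exp (2 * L * t) *\<^sub>R u t = x t" if "t \<in> {0..T}" for t
  proof -
    have "clamp 0 T t = t" using that clamp_cancel_cbox[of t 0 T] by simp
    then have "u t = exp (-(2 * L * t)) *\<^sub>R x t"
      using P[of u t] unfolding u by (simp add: \<Phi>_def x_def)
    then show ?thesis by (simp add: exp_minus)
  qed
  have "(x has_vector_derivative G (exp (2 * L * t) *\<^sub>R u t)) (at t within {0..T})" if "t \<in> {0..T}" for t
    unfolding x_def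
    using integral_has_vector_derivative[OF cont_integrand that, of u]
    by (auto intro!: derivative_eq_intros)
  with xu have "\<forall>t\<in>{0..T}. (x has_vector_derivative G (x t)) (at t within {0..T})" by simp
  moreover have "x 0 = x0" by (simp add: x_def)
  ultimately show ?thesis by blast
qed

subsection \<open>Norms with supporting functionals\<close>

text \<open>The supporting functional takes the place of the triangle inequality: it implies it, and
  it turns a bound on a vector-valued derivative into a scalar one. Both weighted norms have an
  explicit one, so the dynamics are treated once for both.\<close>

locale supported_norm =
  fixes nrm :: "'a::euclidean_space \<Rightarrow> real"
  assumes nrm_scaleR: "nrm (c *\<^sub>R x) = \<bar>c\<bar> * nrm x"
    and nrm_eq_0D: "nrm x = 0 \<Longrightarrow> x = 0"
    and support: "\<exists>w. w \<bullet> y = nrm y \<and> (\<forall>x. w \<bullet> x \<le> nrm x)"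
begin

lemma nrm_zero [simp]: "nrm 0 = 0"
  using nrm_scaleR[of 0 0] by simp

lemma nrm_minus [simp]: "nrm (- x) = nrm x"
  using nrm_scaleR[of "-1" x] by simp

lemma nrm_triangle: "nrm (x + y) \<le> nrm x + nrm y"
  using support[of "x + y"] by (metis add_mono inner_add_right)

lemma nrm_nonneg [simp]: "0 \<le> nrm x"
  using nrm_triangle[of x "- x"] by simp

lemma nrm_pos: "x \<noteq> 0 \<Longrightarrow> 0 < nrm x"
  using nrm_eq_0D[of x] nrm_nonneg[of x] by linarith

lemma nrm_convex: "convex_on UNIV nrm"
  unfolding convex_on_def
  by (auto intro: order_trans[OF nrm_triangle] simp: nrm_scaleR)

lemma continuous_on_nrm: "continuous_on S nrm"
  using convex_on_continuous[OF open_UNIV nrm_convex] continuous_on_subset by blast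

text \<open>By compactness of the unit sphere. It links \<open>nrm\<close> with the Euclidean norm,
  in which projection and Picard iteration work and by which the supremum in
  \<open>induced_norm\<close> is seen to be finite.\<close>

lemma nrm_equivalent:
  obtains c C where "0 < c" "0 < C" "\<And>x. c * norm x \<le> nrm x" "\<And>x. nrm x \<le> C * norm x"
proof -
  let ?S = "sphere (0::'a) 1"
  have S: "compact ?S" "?S \<noteq> {}"
    by (auto simp: sphere_eq_empty)
  obtain l where l: "l \<in> ?S" "\<And>x. x \<in> ?S \<Longrightarrow> nrm l \<le> nrm x"
    using continuous_attains_inf[OF S continuous_on_nrm] by blast
  obtain u where u: "u \<in> ?S" "\<And>x. x \<in> ?S \<Longrightarrow> nrm x \<le> nrm u"
    using continuous_attains_sup[OF S continuous_on_nrm] by blast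
  have *: "nrm x = norm x * nrm (x /\<^sub>R norm x)" "x /\<^sub>R norm x \<in> ?S" if "x \<noteq> 0" for x
    using that by (auto simp: nrm_scaleR)
  show thesis
  proof (rule that[of "nrm l" "nrm u"])
    show "0 < nrm l" "0 < nrm u" using l(1) u(1) by (auto intro!: nrm_pos)
    show "nrm l * norm x \<le> nrm x" "nrm x \<le> nrm u * norm x" for x
      using *[of x] l(2)[of "x /\<^sub>R norm x"] u(2)[of "x /\<^sub>R norm x"]
      by (cases "x = 0"; simp add: mult.commute mult_left_mono)+
  qed
qed

text \<open>With \<open>w\<close> supporting the total increment x t - x 0, the scalar \<phi> - w .
  x is nondecreasing. Derivatives are asked for only at interior times, since at a sampling instant
  the trajectory has only a one-sided one.\<close>

lemma nrm_increment_le: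
  fixes \<phi> :: "real \<Rightarrow> real" and x :: "real \<Rightarrow> 'a"
  assumes t: "0 \<le> t"
    and x: "continuous_on {0..t} x" "\<And>s. 0 < s \<Longrightarrow> s < t \<Longrightarrow> (x has_vector_derivative x' s) (at s)"
    and \<phi>: "continuous_on {0..t} \<phi>" "\<And>s. 0 < s \<Longrightarrow> s < t \<Longrightarrow> (\<phi> has_real_derivative \<phi>' s) (at s)"
    and le: "\<And>s. 0 < s \<Longrightarrow> s < t \<Longrightarrow> nrm (x' s) \<le> \<phi>' s"
  shows "nrm (x t - x 0) \<le> \<phi> t - \<phi> 0"
proof -
  obtain w where w: "w \<bullet> (x t - x 0) = nrm (x t - x 0)" "\<And>y. w \<bullet> y \<le> nrm y"
    using support by blast
  have "\<phi> 0 - w \<bullet> x 0 \<le> \<phi> t - w \<bullet> x t"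
  proof (rule DERIV_nonneg_imp_increasing_open[OF t])
    fix s assume s: "0 < s" "s < t"
    have "((\<lambda>s. \<phi> s - w \<bullet> x s) has_real_derivative \<phi>' s - w \<bullet> x' s) (at s)"
      using \<phi>(2)[OF s] x(2)[OF s]
      unfolding has_real_derivative_iff_has_vector_derivative
      by (auto intro!: derivative_intros
          bounded_linear.has_vector_derivative[OF bounded_linear_inner_right])
    then show "\<exists>y. ((\<lambda>s. \<phi> s - w \<bullet> x s) has_real_derivative y) (at s) \<and> 0 \<le> y"
      using w(2)[of "x' s"] le[OF s] by force
  qed (intro continuous_intros x(1) \<phi>(1))
  then show ?thesis using w(1) by (simp add: inner_diff_right)
qed

lemma convex_nrm_ball: "convex {x. nrm (x - z) < r}"
proof (rule convexI)
  fix x y and u v :: real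
  assume *: "x \<in> {x. nrm (x - z) < r}" "y \<in> {x. nrm (x - z) < r}" "0 \<le> u" "0 \<le> v" "u + v = 1"
  have "u *\<^sub>R x + v *\<^sub>R y - z = u *\<^sub>R (x - z) + v *\<^sub>R (y - z)"
    using *(5) by (simp add: algebra_simps flip: scaleR_add_left)
  then have "nrm (u *\<^sub>R x + v *\<^sub>R y - z) \<le> u * nrm (x - z) + v * nrm (y - z)"
    using nrm_triangle[of "u *\<^sub>R (x - z)" "v *\<^sub>R (y - z)"] * by (simp add: nrm_scaleR)
  also have "\<dots> < r" using * by (intro convex_bound_lt) auto
  finally show "u *\<^sub>R x + v *\<^sub>R y \<in> {x. nrm (x - z) < r}" by simp
qed

lemma open_nrm_ball: "open {x. nrm (x - z) < r}"
  by (intro open_Collect_less continuous_intros continuous_on_compose2[OF continuous_on_nrm[of UNIV]])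
    auto

text \<open>Apply the increment bound to F along the segment from y to x, which convexity keeps in
  \<open>S\<close>.\<close>

lemma lipschitz_of_derivative_bound:
  assumes S: "convex S" and xy: "x \<in> S" "y \<in> S"
    and der: "\<And>z. z \<in> S \<Longrightarrow> (F has_derivative F' z) (at z)"
    and le: "\<And>z v. z \<in> S \<Longrightarrow> nrm (F' z v) \<le> B * nrm v"
  shows "nrm (F x - F y) \<le> B * nrm (x - y)"
proof -
  let ?p = "\<lambda>s. y + s *\<^sub>R (x - y)"
  have p: "?p s \<in> S" if "0 \<le> s" "s \<le> 1" for s
    using convexD_alt[OF S xy(2,1), of s] that by (simp add: algebra_simps)
  have d: "((\<lambda>s. F (?p s)) has_vector_derivative F' (?p s) (x - y)) (at s)"
    if s: "0 \<le> s" "s \<le> 1" for s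
  proof -
    have "(?p has_vector_derivative (x - y)) (at s)"
      by (auto intro!: derivative_eq_intros)
    from vector_derivative_diff_chain_within[OF this, of F "F' (?p s)"]
    show ?thesis using has_derivative_at_withinI[OF der[OF p[OF s]]] by (simp add: o_def)
  qed
  have "nrm (F (?p 1) - F (?p 0)) \<le> B * nrm (x - y) * 1 - B * nrm (x - y) * 0"
  proof (rule nrm_increment_le)
    show "continuous_on {0..1} (\<lambda>s. F (?p s))"
      using d by (auto intro!: continuous_at_imp_continuous_on has_vector_derivative_continuous)
    show "((\<lambda>s. B * nrm (x - y) * s) has_real_derivative B * nrm (x - y)) (at s)" for s
      by (auto intro!: derivative_eq_intros)
  qed (auto intro!: d p le continuous_intros)
  then show ?thesis by simp
qed

subsection \<open>Comparison with the Euler step\<close>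


text \<open>The increment bound is used twice. As |F| is at most A, x has drifted by at most k A s
  at time s; so F has changed by at most B k A s, and integrating k times this gives the quadratic
  term.\<close>

lemma euler_step_bound:
  assumes k: "0 \<le> k" and t: "0 \<le> t" and B: "0 \<le> B"
    and cont: "continuous_on {0..t} x"
    and deriv: "\<And>s. 0 < s \<Longrightarrow> s < t \<Longrightarrow> (x has_vector_derivative k *\<^sub>R F (x s)) (at s)"
    and stays: "\<And>s. 0 < s \<Longrightarrow> s < t \<Longrightarrow> nrm (x s) < r"
    and F_le: "\<And>y. nrm y < r \<Longrightarrow> nrm (F y) \<le> A"
    and F_lip: "\<And>y. nrm y < r \<Longrightarrow> nrm (F y - F (x 0)) \<le> B * nrm (y - x 0)"
  shows "nrm (x t) \<le> nrm (x 0 + (k * t) *\<^sub>R F (x 0)) + A * B * (k * t)\<^sup>2 / 2"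
proof -
  have drift: "nrm (x s - x 0) \<le> k * A * s" if s: "0 < s" "s < t" for s
  proof -
    have "nrm (x s - x 0) \<le> k * A * s - k * A * 0"
    proof (rule nrm_increment_le)
      show "continuous_on {0..s} x" using cont by (rule continuous_on_subset) (use s in auto)
      show "((\<lambda>s. k * A * s) has_real_derivative k * A) (at u)" for u
        by (auto intro!: derivative_eq_intros)
      show "nrm (k *\<^sub>R F (x u)) \<le> k * A" if "0 < u" "u < s" for u
        using F_le[OF stays[of u]] that s k by (simp add: nrm_scaleR mult_left_mono)
    qed (use s in \<open>auto intro!: deriv continuous_intros\<close>)
    then show ?thesis by simp
  qed
  let ?y = "\<lambda>s. x s - (k * s) *\<^sub>R F (x 0)"
  have "nrm (?y t - ?y 0) \<le> A * B * (k * t)\<^sup>2 / 2 - A * B * (k * 0)\<^sup>2 / 2"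
  proof (rule nrm_increment_le[OF t])
    show "(?y has_vector_derivative k *\<^sub>R (F (x s) - F (x 0))) (at s)" if "0 < s" "s < t" for s
      using deriv[OF that]
      by (auto intro!: derivative_eq_intros simp: scaleR_diff_right)
    show "((\<lambda>s. A * B * (k * s)\<^sup>2 / 2) has_real_derivative A * B * k\<^sup>2 * s) (at s)" for s
      by (auto intro!: derivative_eq_intros simp: power2_eq_square algebra_simps)
    show "nrm (k *\<^sub>R (F (x s) - F (x 0))) \<le> A * B * k\<^sup>2 * s" if s: "0 < s" "s < t" for s
    proof -
      have "nrm (F (x s) - F (x 0)) \<le> B * (k * A * s)"
        using F_lip[OF stays[OF s]] mult_left_mono[OF drift[OF s] B] by linarith
      then have "k * nrm (F (x s) - F (x 0)) \<le> k * (B * (k * A * s))"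
        using k by (rule mult_left_mono)
      then show ?thesis using k by (simp add: nrm_scaleR power2_eq_square mult_ac)
    qed
  qed (intro continuous_intros cont; simp)+
  then have "nrm (x t - (x 0 + (k * t) *\<^sub>R F (x 0))) \<le> A * B * (k * t)\<^sup>2 / 2"
    by (simp add: algebra_simps)
  then show ?thesis
    using nrm_triangle[of "x 0 + (k * t) *\<^sub>R F (x 0)" "x t - (x 0 + (k * t) *\<^sub>R F (x 0))"]
    by simp
qed

text \<open>The differential equation is assumed only while x is inside the ball, so that the lemma
  also applies to solutions of an equation that agrees with F only there.\<close>

lemma euler_step_trapped:
  assumes k: "0 \<le> k" and B: "0 \<le> B"
    and cont: "continuous_on {0..T} x"
    and deriv: "\<And>s. 0 < s \<Longrightarrow> s < T \<Longrightarrow> nrm (x s) < r \<Longrightarrow>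
      (x has_vector_derivative k *\<^sub>R F (x s)) (at s)"
    and F_le: "\<And>y. nrm y < r \<Longrightarrow> nrm (F y) \<le> A"
    and F_lip: "\<And>y. nrm y < r \<Longrightarrow> nrm (F y - F (x 0)) \<le> B * nrm (y - x 0)"
    and init: "nrm (x 0) < r"
    and decr: "\<And>s. 0 \<le> s \<Longrightarrow> s \<le> T \<Longrightarrow>
      nrm (x 0 + (k * s) *\<^sub>R F (x 0)) + A * B * (k * s)\<^sup>2 / 2 \<le> nrm (x 0)"
    and t: "0 \<le> t" "t \<le> T"
  shows "nrm (x t) \<le> nrm (x 0 + (k * t) *\<^sub>R F (x 0)) + A * B * (k * t)\<^sup>2 / 2"
proof -
  have bound: "nrm (x s) \<le> nrm (x 0 + (k * s) *\<^sub>R F (x 0)) + A * B * (k * s)\<^sup>2 / 2"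
    if s: "0 \<le> s" "s \<le> T" and stays: "\<And>u. 0 < u \<Longrightarrow> u < s \<Longrightarrow> nrm (x u) < r" for s
  proof (rule euler_step_bound[OF k s(1) B, where x = x and F = F and r = r])
    show "continuous_on {0..s} x" using cont by (rule continuous_on_subset) (use s in auto)
    show "(x has_vector_derivative k *\<^sub>R F (x u)) (at u)" if "0 < u" "u < s" for u
      using that s by (intro deriv stays) linarith+
    show "nrm (x u) < r" if "0 < u" "u < s" for u using that by (rule stays)
    show "nrm (F y) \<le> A" if "nrm y < r" for y using that by (rule F_le)
    show "nrm (F y - F (x 0)) \<le> B * nrm (y - x 0)" if "nrm y < r" for y
      using that by (rule F_lip)
  qed
  have inside: "nrm (x s) < r" if "s \<in> {0..T}" for s
  proof (rule ccontr)
    \<comment> \<open>The times at which x is outside. The least of them is the first exit time,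
      where \<open>bound\<close> and \<open>decr\<close> still apply and contradict
      \<open>init\<close>.\<close>
    let ?E = "{0..T} \<inter> (\<lambda>u. nrm (x u)) -` {r..}"
    assume "\<not> nrm (x s) < r"
    then have "s \<in> ?E" using that by simp
    then have "?E \<noteq> {}" by blast
    moreover have "compact ?E"
    proof -
      have "continuous_on {0..T} (\<lambda>u. nrm (x u))"
        using continuous_on_compose2[OF continuous_on_nrm[of UNIV] cont] by simp
      then have "closed ?E" by (intro continuous_closed_preimage) auto
      then show ?thesis
        by (meson bounded_Int bounded_closed_interval compact_eq_bounded_closed)
    qed
    ultimately obtain u where u: "u \<in> ?E" "\<And>v. v \<in> ?E \<Longrightarrow> u \<le> v"
      using compact_attains_inf[of ?E] by (metis (lifting))
    have "nrm (x v) < r" if "0 < v" "v < u" for v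
    proof (rule ccontr)
      assume "\<not> nrm (x v) < r"
      then have "v \<in> ?E" using u(1) that by simp
      then show False using u(2) that(2) by (meson not_le)
    qed
    then have "nrm (x u) \<le> nrm (x 0)"
      using bound[of u] decr[of u] u(1) by (meson IntD1 atLeastAtMost_iff order_trans)
    with u(1) init show False by simp
  qed
  show ?thesis
  proof (rule bound[OF t(1) t(2)])
    show "nrm (x u) < r" if "0 < u" "u < t" for u using inside[of u] that t by simp
  qed
qed

lemma euler_step_exists:
  assumes k: "0 \<le> k" and T: "0 \<le> T" and B: "0 \<le> B"
    and F_le: "\<And>y. nrm y < r \<Longrightarrow> nrm (F y) \<le> A"
    and F_lip: "\<And>y z. nrm y < r \<Longrightarrow> nrm z < r \<Longrightarrow> nrm (F y - F z) \<le> B * nrm (y - z)"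
    and init: "nrm x0 < r"
    and decr: "\<And>s. 0 \<le> s \<Longrightarrow> s \<le> T \<Longrightarrow>
      nrm (x0 + (k * s) *\<^sub>R F x0) + A * B * (k * s)\<^sup>2 / 2 \<le> nrm x0"
  obtains x where "x 0 = x0"
    "\<And>t. t \<in> {0..T} \<Longrightarrow> (x has_vector_derivative k *\<^sub>R F (x t)) (at t within {0..T})"
    "\<And>t. t \<in> {0..T} \<Longrightarrow> nrm (x t) \<le> nrm x0"
proof -
  \<comment> \<open>The projection needs a closed set, but F is controlled on an open ball. An
    intermediate radius gives a closed ball that still has x0 strictly inside, as the trapping
    argument requires.\<close>
  obtain r' where r': "nrm x0 < r'" "r' < r" using init dense by blast
  have r'_pos: "0 < r'" using r'(1) nrm_nonneg[of x0] by linarith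
  define S where "S = {y. nrm y \<le> r'}"
  have S: "convex S" "closed S" "S \<noteq> {}"
  proof -
    show "convex S"
      unfolding S_def convex_def
    proof safe
      fix y z and u v :: real
      assume "nrm y \<le> r'" "nrm z \<le> r'" "0 \<le> u" "0 \<le> v" "u + v = 1"
      then show "nrm (u *\<^sub>R y + v *\<^sub>R z) \<le> r'"
        using nrm_triangle[of "u *\<^sub>R y" "v *\<^sub>R z"] convex_bound_le[of "nrm y" r' "nrm z" u v]
        by (simp add: nrm_scaleR)
    qed
    show "closed S"
      unfolding S_def by (intro closed_Collect_le continuous_on_nrm continuous_on_const)
    show "S \<noteq> {}" using r'_pos by (auto simp: S_def intro!: exI[of _ 0])
  qed
  \<comment> \<open>F is only controlled inside the ball; composing it with the projection makes it globally
    Lipschitz, and the solution never notices the change\<close>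
  define G where "G y = k *\<^sub>R F (closest_point S y)" for y
  obtain c C where c: "0 < c" "0 < C" "\<And>x. c * norm x \<le> nrm x" "\<And>x. nrm x \<le> C * norm x"
    using nrm_equivalent by blast
  \<comment> \<open>C / c is the price of passing from \<open>nrm\<close> to the Euclidean norm, in
    which the projection is nonexpansive. The summand 1 keeps L positive when the first term
    vanishes, as for k = 0.\<close>
  define L where "L = k * (B * C / c) + 1"
  have L: "0 < L" using k B c by (simp add: L_def add_nonneg_pos)
  have G_lip: "norm (G y - G z) \<le> L * norm (y - z)" for y z
  proof -
    let ?y = "closest_point S y" and ?z = "closest_point S z"
    have "?y \<in> S" "?z \<in> S" using S by (auto intro: closest_point_in_set)
    then have "nrm (F ?y - F ?z) \<le> B * nrm (?y - ?z)"
      using r' by (intro F_lip) (auto simp: S_def)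
    also have "\<dots> \<le> B * (C * norm (?y - ?z))" using c B by (intro mult_left_mono) auto
    also have "\<dots> \<le> B * (C * norm (y - z))"
      using c B closest_point_lipschitz[OF S, of y z]
      by (intro mult_left_mono) (auto simp: dist_norm)
    finally have "c * norm (F ?y - F ?z) \<le> B * (C * norm (y - z))"
      using c(3) order_trans by blast
    then have "norm (F ?y - F ?z) \<le> B * C / c * norm (y - z)"
      using c by (simp add: field_simps)
    then have "k * norm (F ?y - F ?z) \<le> k * (B * C / c * norm (y - z))"
      using k by (rule mult_left_mono)
    moreover have "norm (G y - G z) = k * norm (F ?y - F ?z)"
      using k unfolding G_def scaleR_diff_right[symmetric] norm_scaleR by simp
    ultimately have "norm (G y - G z) \<le> k * (B * C / c) * norm (y - z)"
      by (simp only: mult.assoc)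
    also have "\<dots> \<le> L * norm (y - z)" by (intro mult_right_mono) (auto simp: L_def)
    finally show ?thesis .
  qed
  obtain x where x: "x 0 = x0"
    "\<And>t. t \<in> {0..T} \<Longrightarrow> (x has_vector_derivative G (x t)) (at t within {0..T})"
    using picard_lindelof_global[OF L G_lip T] by metis
  have G_eq: "G y = k *\<^sub>R F y" if "nrm y \<le> r'" for y
    using that by (simp add: G_def S_def closest_point_self)
  have le: "nrm (x t) \<le> nrm x0" if t: "t \<in> {0..T}" for t
  proof -
    have "nrm (x t) \<le> nrm (x 0 + (k * t) *\<^sub>R F (x 0)) + A * B * (k * t)\<^sup>2 / 2"
    proof (rule euler_step_trapped[OF k B, where x = x and F = F and r = r' and T = T])
      show "continuous_on {0..T} x"
        unfolding continuous_on_eq_continuous_within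
        using x(2) has_vector_derivative_continuous by blast
      show "(x has_vector_derivative k *\<^sub>R F (x s)) (at s)"
        if "0 < s" "s < T" "nrm (x s) < r'" for s
        using x(2)[of s] that G_eq[of "x s"] by (simp add: at_within_Icc_at)
      show "nrm (F y) \<le> A" if "nrm y < r'" for y using that r' by (intro F_le) simp
      show "nrm (F y - F (x 0)) \<le> B * nrm (y - x 0)" if "nrm y < r'" for y
        using that r' x(1) by (intro F_lip) auto
      show "nrm (x 0 + (k * s) *\<^sub>R F (x 0)) + A * B * (k * s)\<^sup>2 / 2 \<le> nrm (x 0)"
        if "0 \<le> s" "s \<le> T" for s
        using decr[OF that] x(1) by simp
    qed (use t r' x(1) in auto)
    then show ?thesis using decr[of t] t x(1) by auto
  qed
  show thesis
  proof (rule that[of x, OF x(1) _ le])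
    fix t assume "t \<in> {0..T}"
    then show "(x has_vector_derivative k *\<^sub>R F (x t)) (at t within {0..T})"
      using x(2) G_eq[of "x t"] le[of t] r' by fastforce
  qed
qed

end

subsection \<open>Weighted and induced norms\<close>

lemma supported_norm_norm: "supported_norm (norm :: 'a::euclidean_space \<Rightarrow> real)"
proof
  fix y :: 'a
  show "\<exists>w. w \<bullet> y = norm y \<and> (\<forall>x. w \<bullet> x \<le> norm x)"
  proof (intro exI conjI allI)
    show "sgn y \<bullet> y = norm y"
      by (cases "y = 0") (simp_all add: sgn_div_norm dot_square_norm power2_eq_square)
    fix x
    have "sgn y \<bullet> x \<le> norm (sgn y) * norm x" by (rule norm_cauchy_schwarz)
    also have "\<dots> \<le> 1 * norm x" by (intro mult_right_mono) (auto simp: norm_sgn)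
    finally show "sgn y \<bullet> x \<le> norm x" by simp
  qed
qed auto

text \<open>The supporting functional reads off, with its sign, a coordinate at which the maximum is
  attained.\<close>

lemma supported_norm_infnorm: "supported_norm (infnorm :: 'a::euclidean_space \<Rightarrow> real)"
proof
  fix y :: 'a
  have "infnorm y \<in> (\<lambda>i. \<bar>y \<bullet> i\<bar>) ` Basis"
    unfolding infnorm_Max by (intro Max_in) auto
  then obtain i where i: "i \<in> Basis" "infnorm y = \<bar>y \<bullet> i\<bar>" by blast
  show "\<exists>w. w \<bullet> y = infnorm y \<and> (\<forall>x. w \<bullet> x \<le> infnorm x)"
  proof (intro exI conjI allI)
    show "(sgn (y \<bullet> i) *\<^sub>R i) \<bullet> y = infnorm y"
      by (simp add: i(2) inner_commute[of i] abs_sgn mult.commute)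
    fix x
    have "(sgn (y \<bullet> i) *\<^sub>R i) \<bullet> x \<le> \<bar>x \<bullet> i\<bar>"
      by (auto simp: inner_commute[of i] sgn_if)
    also have "\<dots> \<le> infnorm x" by (rule Basis_le_infnorm[OF i(1)])
    finally show "(sgn (y \<bullet> i) *\<^sub>R i) \<bullet> x \<le> infnorm x" .
  qed
qed (auto simp: infnorm_mul infnorm_eq_0)

text \<open>A functional supporting \<open>n\<close> at D y is pulled back along D to one supporting
  the composition at y; injectivity of D gives definiteness.\<close>

lemma supported_norm_matrix_comp:
  fixes D :: "real^'m^'m"
  assumes "supported_norm n" and inj: "\<And>x. D *v x = 0 \<Longrightarrow> x = 0"
  shows "supported_norm (\<lambda>x. n (D *v x))"
proof -
  interpret supported_norm n by fact
  show ?thesis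
  proof
    fix y :: "real^'m"
    obtain w where "w \<bullet> (D *v y) = n (D *v y)" "\<forall>x. w \<bullet> x \<le> n x" using support by blast
    then show "\<exists>w. w \<bullet> y = n (D *v y) \<and> (\<forall>x. w \<bullet> x \<le> n (D *v x))"
      by (intro exI[of _ "w v* D"]) (simp add: dot_lmul_matrix)
    show "n (D *v (c *\<^sub>R y)) = \<bar>c\<bar> * n (D *v y)" for c
      by (simp add: matrix_vector_mult_scaleR nrm_scaleR)
    show "y = 0" if "n (D *v y) = 0" using inj[OF nrm_eq_0D[OF that]] .
  qed
qed

lemma block_diag_mult_nth: "(block_diag blk w *v x) $ i = w (blk i) * x $ i"
proof -
  have "(block_diag blk w *v x) $ i = (\<Sum>j\<in>UNIV. if j = i then w (blk i) * x $ j else 0)"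
    unfolding block_diag_def matrix_vector_mult_def vec_lambda_beta by (rule sum.cong) auto
  then show ?thesis by simp
qed

lemma supported_norm_weighted:
  assumes "\<And>b. d b \<noteq> 0"
  shows "supported_norm (weighted_norm kind (weight_matrix blk d :: real^'m^'m))"
proof -
  let ?D = "weight_matrix blk d :: real^'m^'m"
  have inj: "x = 0" if "?D *v x = 0" for x
  proof -
    have "(?D *v x) $ i = 0" for i using that by simp
    then show ?thesis
      using assms by (auto simp: weight_matrix_def block_diag_mult_nth vec_eq_iff)
  qed
  note supported_norm_matrix_comp[OF supported_norm_norm inj]
    supported_norm_matrix_comp[OF supported_norm_infnorm inj]
  moreover have "weighted_norm Two ?D = (\<lambda>x. norm (?D *v x))"
    "weighted_norm Infty ?D = (\<lambda>x. infnorm (?D *v x))" by (simp_all add: fun_eq_iff)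
  ultimately show ?thesis by (cases kind) simp_all
qed

text \<open>Diagonal matrices commute, so each coordinate of the weighted vector D x is multiplied
  by its own c, and both norms are monotone in the absolute values of the coordinates.\<close>

lemma weighted_norm_block_diag_le:
  assumes "\<And>b. \<bar>c b\<bar> \<le> m"
  shows "weighted_norm kind (weight_matrix blk d) (block_diag blk c *v x)
    \<le> m * weighted_norm kind (weight_matrix blk d) x"
proof -
  let ?D = "weight_matrix blk d"
  have m: "0 \<le> m" using assms[of undefined] by linarith
  have le: "\<bar>(?D *v (block_diag blk c *v x)) $ i\<bar> \<le> m * \<bar>(?D *v x) $ i\<bar>" for i
  proof -
    have "\<bar>(?D *v (block_diag blk c *v x)) $ i\<bar> = \<bar>c (blk i)\<bar> * \<bar>(?D *v x) $ i\<bar>"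
      by (simp add: weight_matrix_def block_diag_mult_nth abs_mult mult_ac)
    also have "\<dots> \<le> m * \<bar>(?D *v x) $ i\<bar>" using assms by (intro mult_right_mono) auto
    finally show ?thesis .
  qed
  show ?thesis
  proof (cases kind)
    case Two
    have "norm (?D *v (block_diag blk c *v x)) \<le> norm (m *\<^sub>R (?D *v x))"
      by (rule norm_le_componentwise_cart) (use le m in \<open>simp add: abs_mult\<close>)
    then show ?thesis using Two m by simp
  next
    case Infty
    have "infnorm (?D *v (block_diag blk c *v x)) \<le> m * infnorm (?D *v x)"
      unfolding infnorm_cart
    proof (rule cSup_least, goal_cases)
      case (2 z)
      then obtain i where i: "z = \<bar>(?D *v (block_diag blk c *v x)) $ i\<bar>" by blast
      have "z \<le> m * \<bar>(?D *v x) $ i\<bar>" using le i by simp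
      also have "\<dots> \<le> m * infnorm (?D *v x)"
        by (intro mult_left_mono component_le_infnorm_cart m)
      finally show ?case by (simp add: infnorm_cart)
    qed auto
    then show ?thesis using Infty by simp
  qed
qed

text \<open>A real \<open>SUP\<close> is an upper bound only for a set bounded above; comparison
  with the Euclidean operator norm provides the bound.\<close>

lemma nrm_mult_le_induced_norm:
  assumes "supported_norm nrm"
  shows "nrm (M *v x) \<le> induced_norm nrm M * nrm x"
proof -
  interpret supported_norm nrm by fact
  obtain c C where c: "0 < c" "0 < C" "\<And>x. c * norm x \<le> nrm x" "\<And>x. nrm x \<le> C * norm x"
    using nrm_equivalent by blast
  have "nrm (M *v y) / nrm y \<le> C * onorm ((*v) M) / c" for y
  proof (cases "y = 0")
    case True
    then show ?thesis using c onorm_pos_le[OF matrix_vector_mul_bounded_linear, of M] by simp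
  next
    case False
    have "nrm (M *v y) * c \<le> C * norm (M *v y) * c" using c by simp
    also have "\<dots> \<le> C * (onorm ((*v) M) * norm y) * c"
      using c onorm[OF matrix_vector_mul_bounded_linear, of M y]
      by (intro mult_right_mono mult_left_mono) auto
    also have "\<dots> = C * onorm ((*v) M) * (c * norm y)" by simp
    also have "\<dots> \<le> C * onorm ((*v) M) * nrm y"
      using c onorm_pos_le[OF matrix_vector_mul_bounded_linear, of M] by (intro mult_left_mono) auto
    finally show ?thesis using c nrm_pos[OF False] by (simp add: field_simps)
  qed
  then have "bdd_above (range (\<lambda>y. nrm (M *v y) / nrm y))" by (auto intro!: bdd_aboveI)
  then have "nrm (M *v x) / nrm x \<le> induced_norm nrm M"
    unfolding induced_norm_def by (intro cSUP_upper) auto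
  then show ?thesis using nrm_pos[of x] by (cases "x = 0") (auto simp: field_simps)
qed

text \<open>The hypothesis 0 \<le> c covers the term at x = 0, whose value is 0 / 0 = 0.\<close>

lemma induced_norm_le:
  assumes "supported_norm nrm" and "0 \<le> c" and "\<And>x. nrm (M *v x) \<le> c * nrm x"
  shows "induced_norm nrm M \<le> c"
proof -
  interpret supported_norm nrm by fact
  have "nrm (M *v x) / nrm x \<le> c" for x
    using assms(2) assms(3)[of x] nrm_pos[of x] by (cases "x = 0") (auto simp: field_simps)
  then show ?thesis unfolding induced_norm_def by (intro cSUP_least) auto
qed

lemma induced_norm_nonneg:
  fixes M :: "real^'m^'m"
  assumes "supported_norm nrm"
  shows "0 \<le> induced_norm nrm M"
proof -
  interpret supported_norm nrm by fact
  have "0 < nrm (1 :: real^'m)" by (rule nrm_pos) simp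
  moreover have "0 \<le> induced_norm nrm M * nrm 1"
    using nrm_mult_le_induced_norm[OF assms, of M 1] nrm_nonneg[of "M *v 1"] by linarith
  ultimately show ?thesis by (simp add: zero_le_mult_iff)
qed

lemma induced_norm_mat_1:
  assumes "supported_norm nrm"
  shows "induced_norm nrm (mat 1 :: real^'m^'m) = 1"
proof (rule antisym)
  interpret supported_norm nrm by fact
  show "induced_norm nrm (mat 1 :: real^'m^'m) \<le> 1"
    by (rule induced_norm_le[OF assms]) auto
  have "0 < nrm (1 :: real^'m)" by (rule nrm_pos) simp
  then show "1 \<le> induced_norm nrm (mat 1 :: real^'m^'m)"
    using nrm_mult_le_induced_norm[OF assms, of "mat 1" 1] by simp
qed

text \<open>The matrix is affine in \<tau> and a norm is convex. This yields the continuity of g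
  and, with the quadratic term, the uniqueness of the positive solution of g = 1.\<close>

lemma convex_on_induced_norm_affine:
  fixes K :: "real^'m^'m"
  assumes nrm: "supported_norm nrm"
  shows "convex_on UNIV (\<lambda>\<tau>. induced_norm nrm (mat 1 - \<tau> *\<^sub>R K))"
proof (rule convex_onI)
  interpret supported_norm nrm by fact
  let ?M = "\<lambda>\<tau>. mat 1 - \<tau> *\<^sub>R K"
  fix \<theta> s t :: real
  assume \<theta>: "0 < \<theta>" "\<theta> < 1"
  show "induced_norm nrm (?M ((1 - \<theta>) *\<^sub>R s + \<theta> *\<^sub>R t))
    \<le> (1 - \<theta>) * induced_norm nrm (?M s) + \<theta> * induced_norm nrm (?M t)"
  proof (rule induced_norm_le[OF nrm])
    show "0 \<le> (1 - \<theta>) * induced_norm nrm (?M s) + \<theta> * induced_norm nrm (?M t)"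
      using \<theta> induced_norm_nonneg[OF nrm] by simp
    fix x
    have "?M ((1 - \<theta>) *\<^sub>R s + \<theta> *\<^sub>R t) = (1 - \<theta>) *\<^sub>R ?M s + \<theta> *\<^sub>R ?M t"
      by (simp add: algebra_simps)
    then have "?M ((1 - \<theta>) *\<^sub>R s + \<theta> *\<^sub>R t) *v x = (1 - \<theta>) *\<^sub>R (?M s *v x) + \<theta> *\<^sub>R (?M t *v x)"
      by (simp add: matrix_vector_mult_add_rdistrib scaleR_matrix_vector_assoc)
    then have "nrm (?M ((1 - \<theta>) *\<^sub>R s + \<theta> *\<^sub>R t) *v x)
        \<le> (1 - \<theta>) * nrm (?M s *v x) + \<theta> * nrm (?M t *v x)"
      using nrm_triangle[of "(1 - \<theta>) *\<^sub>R (?M s *v x)" "\<theta> *\<^sub>R (?M t *v x)"] \<theta>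
      by (simp add: nrm_scaleR)
    also have "\<dots> \<le> (1 - \<theta>) * (induced_norm nrm (?M s) * nrm x) + \<theta> * (induced_norm nrm (?M t) * nrm x)"
      using \<theta> nrm_mult_le_induced_norm[OF nrm] by (intro add_mono mult_left_mono) auto
    finally show "nrm (?M ((1 - \<theta>) *\<^sub>R s + \<theta> *\<^sub>R t) *v x)
        \<le> ((1 - \<theta>) * induced_norm nrm (?M s) + \<theta> * induced_norm nrm (?M t)) * nrm x"
      by (simp add: algebra_simps)
  qed
qed simp

subsection \<open>The step size function g\<close>

text \<open>As the convex part of g is at most 1 - \<mu> t^2 at t and equal to 1 at 0, the quadratic part makes
  g strictly smaller than 1 before t.\<close>
lemma g_fun_less_1:
  assumes nrm: "supported_norm nrm" and \<mu>: "0 < \<mu>" and t: "g_fun nrm K \<mu> t \<le> 1"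
    and s: "0 < s" "s < t"
  shows "g_fun nrm K \<mu> s < 1"
proof -
  let ?N = "\<lambda>\<tau>. induced_norm nrm (mat 1 - \<tau> *\<^sub>R K)"
  define \<theta> where "\<theta> = s / t"
  have \<theta>: "0 < \<theta>" "\<theta> < 1" "s = \<theta> * t" using s by (auto simp: \<theta>_def)
  have "?N s \<le> (1 - \<theta>) * ?N 0 + \<theta> * ?N t"
    using convex_onD[OF convex_on_induced_norm_affine[OF nrm], of \<theta> 0 t K] \<theta> by simp
  also have "\<dots> \<le> (1 - \<theta>) * 1 + \<theta> * (1 - \<mu> * t\<^sup>2)"
    using t \<theta> by (intro add_mono mult_left_mono) (auto simp: g_fun_def induced_norm_mat_1[OF nrm])
  finally have "g_fun nrm K \<mu> s \<le> 1 - \<mu> * t\<^sup>2 * (\<theta> * (1 - \<theta>))"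
    unfolding g_fun_def \<theta>(3) by (simp add: algebra_simps power2_eq_square)
  moreover have "0 < \<mu> * t\<^sup>2 * (\<theta> * (1 - \<theta>))" using \<mu> \<theta> s by simp
  ultimately show ?thesis by linarith
qed

lemma continuous_on_g_fun:
  assumes "supported_norm nrm"
  shows "continuous_on S (g_fun nrm K \<mu>)"
proof -
  have "continuous_on UNIV (g_fun nrm K \<mu>)"
    unfolding g_fun_def
    by (intro continuous_intros convex_on_continuous convex_on_induced_norm_affine assms open_UNIV)
  then show ?thesis by (rule continuous_on_subset) simp
qed

text \<open>\<open>THE\<close> needs exactly one positive solution. By \<open>decr\<close>, g is at
  most 1 at some small positive point, and the quadratic term brings it back up, so one exists; of
  two solutions the smaller would have g < 1 by \<open>g_fun_less_1\<close>.\<close>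

lemma tau_s_works:
  assumes nrm: "supported_norm nrm" and \<mu>: "0 < \<mu>"
    and \<kappa>: "0 < \<kappa>" and \<delta>: "0 < \<delta>"
    and decr: "\<And>\<tau>. 0 \<le> \<tau> \<Longrightarrow> \<tau> \<le> \<delta> \<Longrightarrow> induced_norm nrm (mat 1 - \<tau> *\<^sub>R K) \<le> 1 - \<kappa> * \<tau>"
  shows "0 < tau_s nrm K \<mu> \<and> g_fun nrm K \<mu> (tau_s nrm K \<mu>) = 1"
proof -
  let ?g = "g_fun nrm K \<mu>"
  \<comment> \<open>Up to \<kappa> / \<mu> the quadratic term is at most the linear decrease.
    Starting the intermediate value argument at s > 0 excludes the trivial solution 0.\<close>
  define s where "s = min \<delta> (\<kappa> / \<mu>)"
  have s: "0 < s" "s \<le> \<delta>" "\<mu> * s \<le> \<kappa>"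
    using \<mu> \<kappa> \<delta> by (auto simp: s_def min_def field_simps)
  have "\<mu> * (s * s) \<le> \<kappa> * s" using mult_right_mono[OF s(3), of s] s(1) by (simp add: mult.assoc)
  then have gs: "?g s \<le> 1"
    using decr[of s] s(1,2) unfolding g_fun_def power2_eq_square by linarith
  \<comment> \<open>From t \<ge> 1 and t \<ge> 1 / \<mu> the quadratic term alone reaches 1; the
    summand s puts t to the right of s.\<close>
  define t where "t = s + 1 + 1 / \<mu>"
  have t: "1 \<le> t" "1 / \<mu> \<le> t" "s \<le> t" using s \<mu> by (auto simp: t_def)
  have "1 / \<mu> * 1 \<le> t * t" using t \<mu> by (intro mult_mono) auto
  then have "1 \<le> \<mu> * t\<^sup>2" using \<mu> by (simp add: field_simps power2_eq_square)
  then have gt: "1 \<le> ?g t"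
    using induced_norm_nonneg[OF nrm, of "mat 1 - t *\<^sub>R K"] by (simp add: g_fun_def)
  obtain \<tau> where \<tau>: "s \<le> \<tau>" "?g \<tau> = 1"
    using IVT'[OF gs gt t(3) continuous_on_g_fun[OF nrm]] by blast
  show ?thesis
    unfolding tau_s_def
  proof (rule theI[of _ \<tau>])
    show "0 < \<tau> \<and> ?g \<tau> = 1" using \<tau> s by simp
    fix \<sigma> assume "0 < \<sigma> \<and> ?g \<sigma> = 1"
    then show "\<sigma> = \<tau>"
      using \<tau> s g_fun_less_1[OF nrm \<mu>, of K \<sigma> \<tau>] g_fun_less_1[OF nrm \<mu>, of K \<tau> \<sigma>]
      by (cases \<sigma> \<tau> rule: linorder_cases) auto
  qed
qed

text \<open>\<open>arg_min_on\<close> is a choice operator, so a minimizer must first be shown to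
  exist, by compactness of the interval and continuity of g.\<close>

lemma tau_o_works:
  assumes nrm: "supported_norm nrm" and "0 < tau_s nrm K \<mu>"
  shows "tau_o nrm K \<mu> \<in> {0..tau_s nrm K \<mu>}"
proof -
  let ?g = "g_fun nrm K \<mu>" and ?I = "{0..tau_s nrm K \<mu>}"
  obtain \<tau> where "\<tau> \<in> ?I" "\<And>\<sigma>. \<sigma> \<in> ?I \<Longrightarrow> ?g \<tau> \<le> ?g \<sigma>"
    using continuous_attains_inf[of ?I ?g] continuous_on_g_fun[OF nrm] assms(2) by auto
  then have "is_arg_min ?g (\<lambda>\<tau>. \<tau> \<in> ?I) \<tau>" by (auto simp: is_arg_min_def not_less)
  then have "is_arg_min ?g (\<lambda>\<tau>. \<tau> \<in> ?I) (tau_o nrm K \<mu>)"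
    unfolding tau_o_def arg_min_on_def arg_min_def by (rule someI)
  then show ?thesis by (simp add: is_arg_min_def)
qed

text \<open>The trapping argument needs g \<le> 1 at every intermediate step k s, and not only at
  the final one, which is \<open>tau_o\<close>.\<close>

lemma g_fun_le_1:
  assumes nrm: "supported_norm nrm" and \<mu>: "0 < \<mu>"
    and \<kappa>: "0 < \<kappa>" and \<delta>: "0 < \<delta>"
    and decr: "\<And>\<tau>. 0 \<le> \<tau> \<Longrightarrow> \<tau> \<le> \<delta> \<Longrightarrow> induced_norm nrm (mat 1 - \<tau> *\<^sub>R K) \<le> 1 - \<kappa> * \<tau>"
    and \<tau>: "0 \<le> \<tau>" "\<tau> \<le> tau_o nrm K \<mu>"
  shows "g_fun nrm K \<mu> \<tau> \<le> 1"
proof -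
  let ?s = "tau_s nrm K \<mu>"
  have s: "0 < ?s" "g_fun nrm K \<mu> ?s = 1"
    using tau_s_works[OF nrm \<mu> \<kappa> \<delta> decr] by auto
  have "\<tau> \<le> ?s" using tau_o_works[OF nrm s(1)] \<tau> by simp
  then consider "\<tau> = 0" | "\<tau> = ?s" | "0 < \<tau>" "\<tau> < ?s" using \<tau> by linarith
  then show ?thesis
  proof cases
    case 3
    then show ?thesis using g_fun_less_1[OF nrm \<mu> _ 3, of K] s(2) by simp
  qed (use s in \<open>simp_all add: g_fun_def induced_norm_mat_1[OF nrm]\<close>)
qed

text \<open>For \<tau> up to \<delta>, the reciprocal of the largest gain, all entries 1 - \<tau>
  gain are nonnegative, so they are bounded by the one with the smallest gain \<kappa>. This is the
  negative slope at 0 in quantitative form.\<close>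

lemma induced_norm_block_diag_decreasing:
  fixes blk :: "'m::finite \<Rightarrow> 'b::finite"
  assumes d: "\<And>b. d b \<noteq> 0" and gain: "\<And>b. 0 < gain b"
  obtains \<kappa> \<delta> where "0 < \<kappa>" "0 < \<delta>"
    "\<And>\<tau>. 0 \<le> \<tau> \<Longrightarrow> \<tau> \<le> \<delta> \<Longrightarrow>
      induced_norm (weighted_norm kind (weight_matrix blk d)) (mat 1 - \<tau> *\<^sub>R block_diag blk gain)
        \<le> 1 - \<kappa> * \<tau>"
proof -
  define \<kappa> where "\<kappa> = Min (range gain)"
  define \<delta> where "\<delta> = 1 / Max (range gain)"
  have \<kappa>: "0 < \<kappa>" "\<And>b. \<kappa> \<le> gain b" using gain by (auto simp: \<kappa>_def)
  have max: "0 < Max (range gain)" "\<And>b. gain b \<le> Max (range gain)"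
    using gain by (auto simp: Max_gr_iff)
  show thesis
  proof (rule that[OF \<kappa>(1)])
    show "0 < \<delta>" using max by (simp add: \<delta>_def)
    fix \<tau> :: real assume \<tau>: "0 \<le> \<tau>" "\<tau> \<le> \<delta>"
    have le: "\<bar>1 - \<tau> * gain b\<bar> \<le> 1 - \<kappa> * \<tau>" for b
    proof -
      have "\<tau> * gain b \<le> \<delta> * Max (range gain)" using \<tau> max gain[of b] by (intro mult_mono) auto
      also have "\<dots> = 1" using max by (simp add: \<delta>_def)
      finally have "\<tau> * gain b \<le> 1" .
      moreover have "\<kappa> * \<tau> \<le> \<tau> * gain b" using \<tau> \<kappa>(2)[of b] by (simp add: mult.commute[of \<kappa>] mult_left_mono)
      ultimately show ?thesis by linarith
    qed
    have eq: "mat 1 - \<tau> *\<^sub>R block_diag blk gain = block_diag blk (\<lambda>b. 1 - \<tau> * gain b)"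
      by (auto simp: vec_eq_iff block_diag_def mat_def)
    show "induced_norm (weighted_norm kind (weight_matrix blk d)) (mat 1 - \<tau> *\<^sub>R block_diag blk gain)
        \<le> 1 - \<kappa> * \<tau>"
      unfolding eq
    proof (rule induced_norm_le[OF supported_norm_weighted[OF d]])
      show "0 \<le> 1 - \<kappa> * \<tau>" using le[of undefined] by linarith
    qed (intro weighted_norm_block_diag_le le)
  qed
qed

subsection \<open>Differentiability of the pseudo-inverse\<close>

lemma differentiable_prod:
  fixes f :: "'i \<Rightarrow> 'a::real_normed_vector \<Rightarrow> 'b::real_normed_field"
  assumes "\<And>i. i \<in> I \<Longrightarrow> f i differentiable (at x within S)"
  shows "(\<lambda>x. \<Prod>i\<in>I. f i x) differentiable (at x within S)"
  using assms
proof (induction I rule: infinite_finite_induct)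
  case (insert i I)
  then show ?case using differentiable_mult[of "f i" x S "\<lambda>x. \<Prod>i\<in>I. f i x"] by simp
qed simp_all

lemma differentiable_vec_nth_iff:
  fixes f :: "'a::real_normed_vector \<Rightarrow> real^'n"
  shows "f differentiable (at x within S) \<longleftrightarrow> (\<forall>i. (\<lambda>y. f y $ i) differentiable (at x within S))"
  unfolding differentiable_componentwise_within[of f] Basis_vec_def by (simp add: inner_axis)

lemma differentiable_det:
  fixes M :: "'a::real_normed_vector \<Rightarrow> real^'n^'n"
  assumes "\<And>i j. (\<lambda>y. M y $ i $ j) differentiable (at x within S)"
  shows "(\<lambda>y. det (M y)) differentiable (at x within S)"
  unfolding det_def
proof (intro differentiable_sum ballI)
  fix p
  show "(\<lambda>y. of_int (sign p) * (\<Prod>i\<in>UNIV. M y $ i $ p i)) differentiable (at x within S)"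
    by (rule differentiable_mult[OF differentiable_const differentiable_prod]) (rule assms)
qed simp

lemma matrix_inv_works:
  assumes "invertible A"
  shows "A ** matrix_inv A = mat 1 \<and> matrix_inv A ** A = mat 1"
  using assms unfolding invertible_def matrix_inv_def by (rule someI_ex)

text \<open>Cramer's rule turns the inverse, defined by choice, into quotients of determinants,
  whose differentiability can be read off.\<close>

lemma matrix_inv_mult_vec:
  fixes A :: "real^'n^'n"
  assumes "det A \<noteq> 0"
  shows "matrix_inv A *v b = (\<chi> k. det (\<chi> i j. if j = k then b $ i else A $ i $ j) / det A)"
proof -
  have "invertible A" using assms by (simp add: invertible_det_nz)
  then have "A *v (matrix_inv A *v b) = b"
    by (simp add: matrix_vector_mul_assoc matrix_inv_works)
  then show ?thesis using cramer[OF assms] by blast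
qed

text \<open>The Cramer formula holds only where the determinant is nonzero; \<open>S\<close> is a
  neighbourhood of x where it is, so that the derivative carries over.\<close>

lemma differentiable_matrix_inv_mult:
  fixes M :: "'a::real_normed_vector \<Rightarrow> real^'n^'n" and v :: "'a \<Rightarrow> real^'n"
  assumes S: "open S" "x \<in> S" and det: "\<And>y. y \<in> S \<Longrightarrow> det (M y) \<noteq> 0"
    and M: "\<And>i j. (\<lambda>y. M y $ i $ j) differentiable (at x)"
    and v: "\<And>i. (\<lambda>y. v y $ i) differentiable (at x)"
  shows "(\<lambda>y. matrix_inv (M y) *v v y) differentiable (at x)"
proof -
  have "(\<lambda>y. \<chi> k. det (\<chi> i j. if j = k then v y $ i else M y $ i $ j) / det (M y)) differentiable (at x)"
    unfolding differentiable_vec_nth_iff vec_lambda_beta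
  proof (intro allI differentiable_divide differentiable_det M)
    show "(\<lambda>y. (\<chi> i j. if j = k then v y $ i else M y $ i $ j) $ i $ j) differentiable (at x)" for i j k
      using M v by (cases "j = k") simp_all
  qed (use S det in auto)
  then obtain F' where "((\<lambda>y. \<chi> k. det (\<chi> i j. if j = k then v y $ i else M y $ i $ j) / det (M y))
      has_derivative F') (at x)"
    by (auto simp: differentiable_def)
  then have "((\<lambda>y. matrix_inv (M y) *v v y) has_derivative F') (at x)"
    by (rule has_derivative_transform_within_open[OF _ S]) (simp add: matrix_inv_mult_vec det)
  then show ?thesis by (auto simp: differentiable_def)
qed

text \<open>If A^T A x = 0 then |A x|^2 = (A^T A x) . x = 0, and full column rank makes A
  injective.\<close>

lemma det_gram_nonzero:
  fixes A :: "real^'m^'n"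
  assumes "rank A = CARD('m)"
  shows "det (transpose A ** A) \<noteq> 0"
proof -
  have "x = 0" if "(transpose A ** A) *v x = 0" for x
  proof -
    have "(A *v x) \<bullet> (A *v x) = ((transpose A ** A) *v x) \<bullet> x"
      by (simp add: dot_lmul_matrix flip: matrix_vector_mul_assoc)
    then have "A *v x = A *v 0" using that by simp
    then show "x = 0" using assms unfolding full_rank_injective by (rule injD[rotated])
  qed
  then have "invertible (transpose A ** A)"
    unfolding invertible_left_inverse matrix_left_invertible_ker by blast
  then show ?thesis by (simp add: invertible_det_nz)
qed

lemma pseudo_inv_left_inverse:
  fixes A :: "real^'m^'n"
  assumes "rank A = CARD('m)"
  shows "pseudo_inv A ** A = mat 1"
  unfolding pseudo_inv_def matrix_mul_assoc[symmetric]
  using det_gram_nonzero[OF assms] by (simp add: matrix_inv_works invertible_det_nz)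

lemma f_field_diag:
  fixes h :: "real^'m \<Rightarrow> real^'n"
  assumes "rank (jac h (qr + e)) = CARD('m)"
  shows "f_field h K qr e e = - (K *v e)"
  by (simp add: f_field_def pseudo_inv_left_inverse[OF assms])

lemma jac_nth: "jac h x $ r $ c = partial_deriv c h x $ r"
  by (simp add: jacobian_def matrix_def partial_deriv_def)

text \<open>The Jacobian has first partial derivatives of \<open>h\<close> as entries, which are
  differentiable by regularity. This makes the matrix in \<open>b_bound\<close> a true
  derivative.\<close>

lemma f_field_differentiable:
  fixes h :: "real^'m \<Rightarrow> real^'n"
  assumes U: "open U" and reg: "regular_on U h" and x: "qr + x \<in> U"
  shows "(\<lambda>x. f_field h K qr x e) differentiable (at x)"
proof -
  have partial: "partial_deriv c h differentiable (at (qr + x))" for c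
  proof -
    have "length [c] < 3" by simp
    then have "iterated_partial [c] h differentiable (at (qr + x))"
      using reg x unfolding regular_on_def Ck_on_def by blast
    then show ?thesis by simp
  qed
  have J: "(\<lambda>y. jac h (qr + y) $ r $ c) differentiable (at x)" for r c
  proof -
    have "(\<lambda>y. partial_deriv c h y $ r) differentiable (at (qr + x))"
      using partial differentiable_vec_nth_iff by blast
    then have "(\<lambda>y. partial_deriv c h (qr + y) $ r) differentiable (at x)"
      by (rule differentiable_compose[where g = "\<lambda>y. qr + y"]) simp
    then show ?thesis by (simp add: jac_nth)
  qed
  \<comment> \<open>The part that depends only on e is split off as a constant vector, so that the
    inverse meets a vector, as Cramer's rule requires.\<close>
  define c where "c = (jac h (qr + e) ** K) *v e"
  let ?A = "\<lambda>y. jac h (qr + y)"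
  have "(\<lambda>y. matrix_inv (transpose (?A y) ** ?A y) *v (transpose (?A y) *v c)) differentiable (at x)"
  proof (rule differentiable_matrix_inv_mult)
    let ?S = "(\<lambda>y. qr + y) -` U"
    show "open ?S" by (intro open_vimage U continuous_intros)
    show "x \<in> ?S" using x by simp
    show "det (transpose (?A y) ** ?A y) \<noteq> 0" if "y \<in> ?S" for y
      using reg that by (intro det_gram_nonzero) (auto simp: regular_on_def)
    show "(\<lambda>y. (transpose (?A y) ** ?A y) $ i $ j) differentiable (at x)" for i j
      unfolding matrix_matrix_mult_def transpose_def vec_lambda_beta
      by (intro differentiable_sum ballI differentiable_mult J) simp
    show "(\<lambda>y. (transpose (?A y) *v c) $ i) differentiable (at x)" for i
      unfolding matrix_vector_mult_def transpose_def vec_lambda_beta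
      by (intro differentiable_sum ballI differentiable_mult J differentiable_const) simp
  qed
  then have "(\<lambda>y. - (matrix_inv (transpose (?A y) ** ?A y) *v (transpose (?A y) *v c))) differentiable (at x)"
    by (rule differentiable_minus)
  then show ?thesis
    unfolding f_field_def c_def pseudo_inv_def matrix_vector_mul_assoc[symmetric] .
qed

subsection \<open>The sampled system\<close>

text \<open>Closed pieces are glued one at a time. Continuity is local, and each t lies in some
  \<open>{0..real n * T}\<close> with t below its right end, a relative neighbourhood in
  \<open>{0..}\<close>.\<close>

lemma continuous_on_nonneg_concat:
  fixes q :: "real \<Rightarrow> 'a::topological_space"
  assumes T: "0 < T" and cont: "\<And>j::nat. continuous_on {real j * T..(real j + 1) * T} q"
  shows "continuous_on {0..} q"
proof -
  have upto: "continuous_on {0..real n * T} q" for n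
  proof (induction n)
    case (Suc n)
    have "{0..real (Suc n) * T} = {0..real n * T} \<union> {real n * T..(real n + 1) * T}"
      using T by (subst ivl_disj_un_two_touch) (auto simp: algebra_simps)
    then show ?case
      using continuous_on_closed_Un[OF _ _ Suc cont[of n]] by simp
  qed simp
  show ?thesis
    unfolding continuous_on_eq_continuous_within
  proof
    fix t :: real assume t: "t \<in> {0..}"
    obtain n :: nat where n: "t < real n * T" using T ex_less_of_nat_mult by blast
    have "continuous (at t within {0..real n * T}) q"
      using upto[of n] t n by (simp add: continuous_on_eq_continuous_within)
    moreover have "at t within {0..real n * T} = at t within {0..}"
      by (rule at_within_nhd[of _ "{..<real n * T}"]) (use n in auto)
    ultimately show "continuous (at t within {0..}) q" by simp
  qed
qed

text \<open>What the dynamics use of the particular gain k is collected in \<open>k_nonneg\<close>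
  and \<open>g_le_1\<close>; \<open>tau_o\<close> enters only when the locale is
  interpreted.\<close>

locale sampled_feedback = supported_norm nrm
  for nrm :: "real^'m \<Rightarrow> real" +
  fixes h :: "real^'m \<Rightarrow> real^'n" and K :: "real^'m^'m" and qr :: "real^'m" and R T k a b :: real
  assumes T_pos: "0 < T" and k_nonneg: "0 \<le> k" and a_nonneg: "0 \<le> a" and b_nonneg: "0 \<le> b"
    and regular: "regular_on (norm_ball nrm qr R) h"
    and a_bound: "\<And>e e'. qr + e \<in> norm_ball nrm qr R \<Longrightarrow> qr + e' \<in> norm_ball nrm qr R \<Longrightarrow>
                     nrm (f_field h K qr e' e) \<le> a * nrm e"
    and b_bound: "\<And>e e'. qr + e \<in> norm_ball nrm qr R \<Longrightarrow> qr + e' \<in> norm_ball nrm qr R \<Longrightarrow>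
                     induced_norm nrm (jacobian (\<lambda>x. f_field h K qr x e) (at e')) \<le> b * nrm e"
    and g_le_1: "\<And>s. 0 \<le> s \<Longrightarrow> s \<le> T \<Longrightarrow> g_fun nrm K (1 / 2 * a * b * R) (k * s) \<le> 1"
begin

abbreviation "g s \<equiv> g_fun nrm K (1 / 2 * a * b * R) (k * s)"

lemma mem_norm_ball: "qr + e \<in> norm_ball nrm qr R \<longleftrightarrow> nrm e < R"
  by (simp add: norm_ball_def)

lemma f_field_le: "nrm e < R \<Longrightarrow> nrm y < R \<Longrightarrow> nrm (f_field h K qr y e) \<le> a * nrm e"
  using a_bound mem_norm_ball by blast

lemma f_field_lipschitz:
  assumes e: "nrm e < R" and y: "nrm y < R" and z: "nrm z < R"
  shows "nrm (f_field h K qr y e - f_field h K qr z e) \<le> b * nrm e * nrm (y - z)"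
proof (rule lipschitz_of_derivative_bound[where F = "\<lambda>y. f_field h K qr y e"])
  show "convex {x. nrm (x - 0) < R}" by (rule convex_nrm_ball)
  show "y \<in> {x. nrm (x - 0) < R}" "z \<in> {x. nrm (x - 0) < R}" using y z by simp_all
  fix u v assume "u \<in> {x. nrm (x - 0) < R}"
  then have u: "nrm u < R" by simp
  have "open (norm_ball nrm qr R)" unfolding norm_ball_def by (rule open_nrm_ball)
  then show "((\<lambda>y. f_field h K qr y e) has_derivative
      (*v) (jacobian (\<lambda>y. f_field h K qr y e) (at u))) (at u)"
    using f_field_differentiable[OF _ regular] u by (simp add: mem_norm_ball jacobian_works)
  have "nrm (jacobian (\<lambda>y. f_field h K qr y e) (at u) *v v)
      \<le> induced_norm nrm (jacobian (\<lambda>y. f_field h K qr y e) (at u)) * nrm v"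
    by (rule nrm_mult_le_induced_norm) (rule supported_norm_axioms)
  also have "\<dots> \<le> b * nrm e * nrm v"
    using b_bound[of e u] e u by (intro mult_right_mono) (auto simp: mem_norm_ball)
  finally show "nrm (jacobian (\<lambda>y. f_field h K qr y e) (at u) *v v) \<le> b * nrm e * nrm v" .
qed

lemma euler_step_le:
  assumes e: "nrm e < R"
  shows "nrm (e + (k * s) *\<^sub>R f_field h K qr e e) + (a * nrm e) * (b * nrm e) * (k * s)\<^sup>2 / 2
    \<le> g s * nrm e"
proof -
  have "rank (jac h (qr + e)) = CARD('m)"
    using regular e by (auto simp: regular_on_def mem_norm_ball)
  then have "e + (k * s) *\<^sub>R f_field h K qr e e = (mat 1 - (k * s) *\<^sub>R K) *v e"
    by (simp add: f_field_diag matrix_vector_mult_diff_rdistrib scaleR_matrix_vector_assoc)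
  then have "nrm (e + (k * s) *\<^sub>R f_field h K qr e e)
      \<le> induced_norm nrm (mat 1 - (k * s) *\<^sub>R K) * nrm e"
    using nrm_mult_le_induced_norm[OF supported_norm_axioms] by simp
  moreover have "(a * nrm e) * (b * nrm e) * (k * s)\<^sup>2 / 2 \<le> 1 / 2 * a * b * R * (k * s)\<^sup>2 * nrm e"
  proof -
    \<comment> \<open>One of the two factors \<open>nrm e\<close> is estimated by R, which produces
      the constant \<mu>.\<close>
    have "(a * b * (k * s)\<^sup>2 / 2 * nrm e) * nrm e \<le> (a * b * (k * s)\<^sup>2 / 2 * nrm e) * R"
      using e a_nonneg b_nonneg by (intro mult_left_mono) auto
    then show ?thesis by (simp add: mult_ac)
  qed
  ultimately show ?thesis unfolding g_fun_def distrib_right by linarith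
qed

lemma g_mult_nrm_le: "0 \<le> s \<Longrightarrow> s \<le> T \<Longrightarrow> g s * nrm e \<le> nrm e"
  using mult_right_mono[OF g_le_1 nrm_nonneg, of s e] by simp

text \<open>Including s = T, which the continuity of q permits, lets one estimate serve both the
  decay from sample to sample and the bound between samples.\<close>

lemma sampled_solution_step:
  assumes q: "sampled_solution h K qr T k q" and e: "nrm (q (real j * T) - qr) < R"
    and s: "0 \<le> s" "s \<le> T"
  shows "nrm (q (real j * T + s) - qr) \<le> g s * nrm (q (real j * T) - qr)"
proof -
  define t0 where "t0 = real j * T"
  have t0: "0 \<le> t0" "(real j + 1) * T = t0 + T" using T_pos by (auto simp: t0_def algebra_simps)
  define x where "x s = q (t0 + s) - qr" for s
  have x0: "x 0 = q (real j * T) - qr" by (simp add: x_def t0_def)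
  let ?F = "\<lambda>y. f_field h K qr y (x 0)"
  have "nrm (x s) \<le> nrm (x 0 + (k * s) *\<^sub>R ?F (x 0)) + (a * nrm (x 0)) * (b * nrm (x 0)) * (k * s)\<^sup>2 / 2"
  proof (rule euler_step_trapped[OF k_nonneg, where x = x and F = ?F and r = R and T = T])
    show "0 \<le> b * nrm (x 0)" using b_nonneg by simp
    have "continuous_on {0..} q" using q by (simp add: sampled_solution_def)
    then show "continuous_on {0..T} x"
      unfolding x_def using t0
      by (intro continuous_intros continuous_on_compose2[of _ q _ "\<lambda>s. t0 + s"]) auto
    show "nrm (x 0) < R" using e x0 by simp
    then show "nrm (?F y) \<le> a * nrm (x 0)" if "nrm y < R" for y
      using f_field_le that by blast
    show "nrm (?F y - ?F (x 0)) \<le> b * nrm (x 0) * nrm (y - x 0)" if "nrm y < R" for y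
      using f_field_lipschitz that \<open>nrm (x 0) < R\<close> by blast
    show "nrm (x 0 + (k * s) *\<^sub>R ?F (x 0)) + (a * nrm (x 0)) * (b * nrm (x 0)) * (k * s)\<^sup>2 / 2 \<le> nrm (x 0)"
      if "0 \<le> s" "s \<le> T" for s
      using euler_step_le[OF \<open>nrm (x 0) < R\<close>] g_mult_nrm_le[OF that] order_trans by blast
    show "(x has_vector_derivative k *\<^sub>R ?F (x s)) (at s)" if s: "0 < s" "s < T" for s
    proof -
      have "(q has_vector_derivative k *\<^sub>R ?F (x s)) (at (t0 + s) within {t0..<t0 + T})"
      proof -
        have "t0 + s \<in> {real j * T..<(real j + 1) * T}" unfolding t0(2) using s by (simp add: t0_def)
        then have "(q has_vector_derivative
           - (k *\<^sub>R ((pseudo_inv (jac h (q (t0 + s))) ** jac h (q (real j * T)) ** K)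
                       *v (q (real j * T) - qr))))
            (at (t0 + s) within {real j * T..<(real j + 1) * T})"
          using q unfolding sampled_solution_def by blast
        then show ?thesis
          unfolding t0(2) t0_def[symmetric] by (simp add: x_def f_field_def)
      qed
      \<comment> \<open>The equation is stated relative to a half-open interval; at an interior time
        this is the ordinary two-sided derivative.\<close>
      moreover have "at (t0 + s) within {t0..<t0 + T} = at (t0 + s)"
        by (rule at_within_interior) (use s in simp)
      ultimately have "((q \<circ> (\<lambda>s. t0 + s)) has_vector_derivative 1 *\<^sub>R k *\<^sub>R ?F (x s)) (at s)"
        by (intro vector_diff_chain_at) (auto intro!: derivative_eq_intros)
      then show ?thesis
        unfolding x_def o_def by (auto intro!: derivative_eq_intros)
    qed
  qed (use s in auto)
  also have "\<dots> \<le> g s * nrm (x 0)" using euler_step_le e x0 by simp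
  finally show ?thesis by (simp add: x_def t0_def)
qed

text \<open>Membership in the ball is carried through the induction, since each step estimate needs
  its starting error to be inside.\<close>

lemma sampled_solution_decay:
  assumes q: "sampled_solution h K qr T k q" and e: "nrm (q 0 - qr) < R"
  shows "nrm (q (real j * T) - qr) < R \<and> nrm (q (real j * T) - qr) \<le> g T ^ j * nrm (q 0 - qr)"
proof (induction j)
  case (Suc j)
  let ?e = "nrm (q (real j * T) - qr)"
  have "0 \<le> R" using e nrm_nonneg[of "q 0 - qr"] by linarith
  then have "0 \<le> 1 / 2 * a * b * R" using a_nonneg b_nonneg by simp
  then have g: "0 \<le> g T"
    using induced_norm_nonneg[OF supported_norm_axioms] by (simp add: g_fun_def)
  have "real (Suc j) * T = real j * T + T" by (simp add: algebra_simps)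
  then have step: "nrm (q (real (Suc j) * T) - qr) \<le> g T * ?e"
    using sampled_solution_step[OF q _ _ order_refl] Suc T_pos by simp
  have "g T * ?e \<le> g T * (g T ^ j * nrm (q 0 - qr))" using Suc g by (intro mult_left_mono) auto
  then show ?case
    using step Suc g_mult_nrm_le[of T "q (real j * T) - qr"] T_pos by (simp add: mult.assoc)
qed (use e in simp)

text \<open>With the sampled error frozen, the system is a chain of autonomous problems; the
  endpoint of one is both the initial value and the parameter of the next.\<close>

lemma sampled_solution_exists:
  assumes q0: "nrm (q0 - qr) < R"
  shows "\<exists>q. sampled_solution h K qr T k q \<and> q 0 = q0"
proof -
  have "\<exists>x. x 0 = e \<and>
      (\<forall>t\<in>{0..T}. (x has_vector_derivative k *\<^sub>R f_field h K qr (x t) e) (at t within {0..T})) \<and>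
      (\<forall>t\<in>{0..T}. nrm (x t) \<le> nrm e)" if e: "nrm e < R" for e
  proof -
    show ?thesis
    proof (rule euler_step_exists[where F = "\<lambda>y. f_field h K qr y e" and ?x0.0 = e and k = k
          and T = T and r = R and A = "a * nrm e" and B = "b * nrm e"])
      show "0 \<le> b * nrm e" using b_nonneg by simp
      show "nrm (e + (k * s) *\<^sub>R f_field h K qr e e) + (a * nrm e) * (b * nrm e) * (k * s)\<^sup>2 / 2 \<le> nrm e"
        if "0 \<le> s" "s \<le> T" for s
        using euler_step_le[OF e] g_mult_nrm_le[OF that] order_trans by blast
    qed (use k_nonneg T_pos e f_field_le f_field_lipschitz in auto)
  qed
  then obtain X where X: "\<And>e. nrm e < R \<Longrightarrow> X e 0 = e"
    "\<And>e t. nrm e < R \<Longrightarrow> t \<in> {0..T} \<Longrightarrow>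
      (X e has_vector_derivative k *\<^sub>R f_field h K qr (X e t) e) (at t within {0..T})"
    "\<And>e t. nrm e < R \<Longrightarrow> t \<in> {0..T} \<Longrightarrow> nrm (X e t) \<le> nrm e"
    by metis
  \<comment> \<open>The errors at the sampling instants form the orbit of the time-T map
    \<open>\<lambda>e. X e T\<close>, where \<open>X e\<close> solves the problem with frozen error
    e.\<close>
  define E where "E j = ((\<lambda>e. X e T) ^^ j) (q0 - qr)" for j
  have E_Suc: "E (Suc j) = X (E j) T" for j by (simp add: E_def)
  have E: "nrm (E j) < R" for j
  proof (induction j)
    case (Suc j)
    then show ?case using X(3)[of "E j" T] T_pos by (simp add: E_Suc)
  qed (simp add: E_def q0)
  define q where "q t = qr + X (E (nat \<lfloor>t / T\<rfloor>)) (t - real (nat \<lfloor>t / T\<rfloor>) * T)" for t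
  have q_eq: "q t = qr + X (E j) (t - real j * T)" if "t \<in> {real j * T..<(real j + 1) * T}" for t j
  proof -
    have "\<lfloor>t / T\<rfloor> = int j" using that T_pos by (intro floor_unique) (auto simp: field_simps)
    then show ?thesis by (simp add: q_def)
  qed
  \<comment> \<open>At the right endpoint q already follows the next piece, which starts where this
    one ends; so the formula extends to the closed interval, as the gluing requires.\<close>
  have q_eq': "q t = qr + X (E j) (t - real j * T)" if "t \<in> {real j * T..(real j + 1) * T}" for t j
  proof (cases "t = (real j + 1) * T")
    case True
    then have "q t = qr + X (E (Suc j)) 0" using q_eq[of t "Suc j"] T_pos by (simp add: algebra_simps)
    also have "\<dots> = qr + X (E j) T" by (simp only: X(1)[OF E] flip: E_Suc)
    finally show ?thesis using True by (simp add: algebra_simps)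
  qed (use that q_eq in simp)
  have q_sample: "q (real j * T) = qr + E j" for j
    using q_eq[of "real j * T" j] T_pos X(1)[OF E] by simp
  have deriv: "((\<lambda>t. qr + X (E j) (t - real j * T)) has_vector_derivative
      k *\<^sub>R f_field h K qr (X (E j) (t - real j * T)) (E j)) (at t within {real j * T..(real j + 1) * T})"
    if t: "t \<in> {real j * T..(real j + 1) * T}" for t j
  proof -
    let ?I = "{real j * T..(real j + 1) * T}" and ?s = "\<lambda>t. t - real j * T"
    have "?s ` ?I \<subseteq> {0..T}" by (auto simp: algebra_simps)
    moreover have "?s t \<in> {0..T}" using t by (auto simp: algebra_simps)
    ultimately have "(X (E j) has_vector_derivative k *\<^sub>R f_field h K qr (X (E j) (?s t)) (E j))
        (at (?s t) within ?s ` ?I)"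
      using X(2)[OF E] has_vector_derivative_within_subset by blast
    moreover have "(?s has_vector_derivative 1) (at t within ?I)"
      by (auto intro!: derivative_eq_intros)
    ultimately have "((X (E j) \<circ> ?s) has_vector_derivative
        1 *\<^sub>R k *\<^sub>R f_field h K qr (X (E j) (?s t)) (E j)) (at t within ?I)"
      by (rule vector_diff_chain_within[rotated])
    then show ?thesis unfolding o_def by (auto intro!: derivative_eq_intros)
  qed
  have "sampled_solution h K qr T k q"
    unfolding sampled_solution_def
  proof (intro conjI allI ballI)
    show "continuous_on {0..} q"
    proof (rule continuous_on_nonneg_concat[OF T_pos])
      fix j
      have "continuous_on {real j * T..(real j + 1) * T} (\<lambda>t. qr + X (E j) (t - real j * T))"
        unfolding continuous_on_eq_continuous_within
        using deriv has_vector_derivative_continuous by blast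
      then show "continuous_on {real j * T..(real j + 1) * T} q"
        by (rule continuous_on_eq) (simp add: q_eq')
    qed
    fix j t assume t: "t \<in> {real j * T..<(real j + 1) * T}"
    have "((\<lambda>t. qr + X (E j) (t - real j * T)) has_vector_derivative
        k *\<^sub>R f_field h K qr (X (E j) (t - real j * T)) (E j)) (at t within {real j * T..<(real j + 1) * T})"
      by (rule has_vector_derivative_within_subset[OF deriv]) (use t in auto)
    then have "(q has_vector_derivative
        k *\<^sub>R f_field h K qr (X (E j) (t - real j * T)) (E j)) (at t within {real j * T..<(real j + 1) * T})"
      by (rule has_vector_derivative_transform[OF t, rotated]) (simp add: q_eq)
    then show "(q has_vector_derivative
           - (k *\<^sub>R ((pseudo_inv (jac h (q t)) ** jac h (q (real j * T)) ** K)
                       *v (q (real j * T) - qr))))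
        (at t within {real j * T..<(real j + 1) * T})"
      by (simp add: f_field_def q_sample flip: q_eq[OF t])
  qed
  moreover have "q 0 = q0" using q_sample[of 0] by (simp add: E_def)
  ultimately show ?thesis by blast
qed

end

text \<open>Existence accompanies the estimates so that they are not vacuous.\<close>

theorem proposition3:
  fixes blk :: "'m::finite \<Rightarrow> 'a::finite option"
    and pblk :: "'n::finite \<Rightarrow> 'a"
    and h :: "real^'m \<Rightarrow> real^'n"
    and d gain :: "'a option \<Rightarrow> real"
    and kind :: norm_kind
    and qr :: "real^'m"
    and R T a b :: real
  defines "nrm \<equiv> weighted_norm kind (weight_matrix blk d)"
    and "K \<equiv> block_diag blk gain"
    and "\<mu> \<equiv> 1 / 2 * a * b * R"
  assumes dims: "CARD('n) > CARD('m)"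
    and star: "star_structure blk pblk h"
    and d_ge_1: "\<And>i. d i \<ge> 1"
    and R_pos: "R > 0"
    and T_pos: "T > 0"
    and gain_pos: "\<And>i. gain i > 0"
    and regular: "regular_on (norm_ball nrm qr R) h"
    and a_pos: "a > 0"
    and b_pos: "b > 0"
    and a_bound: "\<And>e e'. qr + e \<in> norm_ball nrm qr R \<Longrightarrow> qr + e' \<in> norm_ball nrm qr R \<Longrightarrow>
                     nrm (f_field h K qr e' e) \<le> a * nrm e"
    and b_bound: "\<And>e e'. qr + e \<in> norm_ball nrm qr R \<Longrightarrow> qr + e' \<in> norm_ball nrm qr R \<Longrightarrow>
                     induced_norm nrm (jacobian (\<lambda>x. f_field h K qr x e) (at e')) \<le> b * nrm e"
  shows "\<forall>q0\<in>norm_ball nrm qr R.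
           (\<exists>q. sampled_solution h K qr T (tau_o nrm K \<mu> / T) q \<and> q 0 = q0) \<and>
           (\<forall>q. sampled_solution h K qr T (tau_o nrm K \<mu> / T) q \<and> q 0 = q0 \<longrightarrow>
              (\<forall>j::nat. nrm (q (real j * T) - qr) \<le> rho nrm K \<mu> ^ j * nrm (q 0 - qr)) \<and>
              (\<forall>j::nat. \<forall>t. real j * T \<le> t \<and> t < (real j + 1) * T \<longrightarrow>
                 nrm (q t - qr) \<le> nrm (q (real j * T) - qr)))"
proof -
  have d: "d i \<noteq> 0" for i using d_ge_1[of i] by linarith
  have nrm: "supported_norm nrm" unfolding nrm_def by (rule supported_norm_weighted[OF d])
  have \<mu>: "0 < \<mu>" using a_pos b_pos R_pos by (simp add: \<mu>_def)
  obtain \<kappa> \<delta> where \<kappa>: "0 < \<kappa>" "0 < \<delta>"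
    "\<And>\<tau>. 0 \<le> \<tau> \<Longrightarrow> \<tau> \<le> \<delta> \<Longrightarrow> induced_norm nrm (mat 1 - \<tau> *\<^sub>R K) \<le> 1 - \<kappa> * \<tau>"
    unfolding nrm_def K_def
    using induced_norm_block_diag_decreasing[where d = d and gain = gain and kind = kind and blk = blk]
      d gain_pos by metis
  have \<tau>: "0 \<le> tau_o nrm K \<mu>"
    using tau_o_works[OF nrm] tau_s_works[OF nrm \<mu> \<kappa>] by simp
  let ?k = "tau_o nrm K \<mu> / T"
  interpret sampled_feedback nrm h K qr R T ?k a b
  proof (rule sampled_feedback.intro[OF nrm], unfold_locales)
    show "g_fun nrm K (1 / 2 * a * b * R) (?k * s) \<le> 1" if "0 \<le> s" "s \<le> T" for s
    proof -
      have "?k * s \<le> ?k * T" using that \<tau> T_pos by (intro mult_left_mono) auto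
      then have "?k * s \<le> tau_o nrm K \<mu>" using T_pos by simp
      moreover have "0 \<le> ?k * s" using \<tau> T_pos that by simp
      ultimately show ?thesis using g_fun_le_1[OF nrm \<mu> \<kappa>] by (simp add: \<mu>_def)
    qed
  qed (use T_pos \<tau> a_pos b_pos regular a_bound b_bound in auto)
  \<comment> \<open>The abbreviation \<open>g\<close> evaluates at k T, which is
    \<open>tau_o\<close> by the choice of the gain.\<close>
  have rho: "rho nrm K \<mu> = g T" using T_pos by (simp add: rho_def \<mu>_def)
  show ?thesis
  proof (intro ballI conjI allI impI; (elim conjE)?)
    fix q0 assume "q0 \<in> norm_ball nrm qr R"
    then have q0: "nrm (q0 - qr) < R" by (simp add: norm_ball_def)
    show "\<exists>q. sampled_solution h K qr T ?k q \<and> q 0 = q0"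
      by (rule sampled_solution_exists[OF q0])
    fix q and j :: nat assume q: "sampled_solution h K qr T ?k q" "q 0 = q0"
    note decay = sampled_solution_decay[OF q(1) q0[folded q(2)], of j]
    show "nrm (q (real j * T) - qr) \<le> rho nrm K \<mu> ^ j * nrm (q 0 - qr)"
      using decay by (simp add: rho)
    fix t assume "real j * T \<le> t" "t < (real j + 1) * T"
    then have s: "0 \<le> t - real j * T" "t - real j * T \<le> T" by (auto simp: algebra_simps)
    have "nrm (q (real j * T + (t - real j * T)) - qr)
        \<le> g (t - real j * T) * nrm (q (real j * T) - qr)"
      by (rule sampled_solution_step[OF q(1) conjunct1[OF decay] s])
    also have "\<dots> \<le> nrm (q (real j * T) - qr)" by (rule g_mult_nrm_le[OF s])
    finally show "nrm (q t - qr) \<le> nrm (q (real j * T) - qr)" by simp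
  qed
qed

end
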